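(* Let $a<b$, $\alpha\in(0,1)$, $\beta>0$, and let $L:(x,y,v,w,z)\mapsto L(x,y,v,w,z)$ and $l:(x,y,v,w)\mapsto l(x,y,v,w)$ be real-valued functions of class $C^1$. For $y\in\mathcal{F}([a,b];\mathbb{R})$ put $$z(x)=\int_a^x l\bigl(t,y(t),{^C_aD_t^\alpha}y(t),{_aI_t^\beta}y(t)\bigr)\,dt,$$ $\{y\}(x)=(x,y(x),{^C_aD_x^\alpha}y(x),{_aI_x^\beta}y(x))$, $[y](x)=(x,y(x),{^C_aD_x^\alpha}y(x),{_aI_x^\beta}y(x),z(x))$, and $J(y)=\int_a^b L[y](x)\,dx$. Let $y\in\mathcal{F}([a,b];\mathbb{R})$ be a solution of the fractional Euler--Lagrange equation $$\frac{\partial L}{\partial y}[y](x)+{_xD^\alpha_b}\left(\frac{\partial L}{\partial v}[y](x)\right)+{_xI_b^\beta}\left(\frac{\partial L}{\partial w}[y](x)\right)+\int_x^b\frac{\partial L}{\partial z}[y](t)\,dt\cdot\frac{\partial l}{\partial y}\{y\}(x)$$ $$+{_xD^\alpha_b}\left(\int_x^b\frac{\partial L}{\partial z}[y](t)\,dt\cdot\frac{\partial l}{\partial v}\{y\}(x)\right)+{_xI^\beta_b}\left(\int_x^b\frac{\partial L}{\partial z}[y](t)\,dt\cdot\frac{\partial l}{\partial w}\{y\}(x)\right)=0,\quad x\in[a,b],$$ and of the fractional natural boundary condition $$\left[{_xI_b^{1-\alpha}}\left(\frac{\partial L}{\partial v}[y](x)+\int_x^b\frac{\partial L}{\partial z}[y](t)\,dt\cdot\frac{\partial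 l}{\partial v}\{y\}(x)\right)\right]_{x=a}=0.$$ Assume that $L$ is convex in $(y,v,w,z)$. If one of the following two conditions is satisfied: (1) $l$ is convex in $(y,v,w)$ and $\frac{\partial L}{\partial z}[y](x)\geq0$ for all $x\in[a,b]$; (2) $l$ is concave in $(y,v,w)$ and $\frac{\partial L}{\partial z}[y](x)\leq0$ for all $x\in[a,b]$; then $y$ is a (global) minimizer of $J$ over $\mathcal{F}([a,b];\mathbb{R})$ (no boundary conditions imposed).
   Context: For $\gamma>0$, the left and right Riemann--Liouville fractional integrals are ${_aI_x^\gamma}f(x)=\frac{1}{\Gamma(\gamma)}\int_a^x(x-t)^{\gamma-1}f(t)\,dt$ and ${_xI_b^\gamma}f(x)=\frac{1}{\Gamma(\gamma)}\int_x^b(t-x)^{\gamma-1}f(t)\,dt$. For $\alpha\in(0,1)$, the right Riemann--Liouville fractional derivative is ${_xD_b^\alpha}f(x)=\frac{-1}{\Gamma(1-\alpha)}\frac{d}{dx}\int_x^b(t-x)^{-\alpha}f(t)\,dt$, and the left Caputo fractional derivative of an absolutely continuous $f$ is ${^C_aD_x^\alpha}f(x)=\frac{1}{\Gamma(1-\alpha)}\int_a^x(x-t)^{-\alpha}f'(t)\,dt$. $\mathcal{F}([a,b];\mathbb{R})$ denotes the class of absolutely continuous functions $y:[a,b]\to\mathbb{R}$ such that ${^C_aD_x^\alpha}y(x)$ and ${_aI_x^\beta}y(x)$ exist and are continuous on $[a,b]$. Convexity: given $k\in\{1,\ldots,n\}$ and $\Psi:D\subseteq\mathbb{R}^n\to\mathbb{R}$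 such that $\partial\Psi/\partial x_i$ exist and are continuous for all $i\in\{k,\ldots,n\}$, $\Psi$ is convex (concave) in $(x_k,\ldots,x_n)$ if $$\Psi(x_1+\tau_1,\ldots,x_{k-1}+\tau_{k-1},x_k+\tau_k,\ldots,x_n+\tau_n)-\Psi(x_1,\ldots,x_n)\geq(\leq)\sum_{i=k}^n\frac{\partial\Psi}{\partial x_i}(x_1,\ldots,x_n)\tau_i$$ for all $(x_1,\ldots,x_n),(x_1+\tau_1,\ldots,x_n+\tau_n)\in D$. (This is the definition exactly as printed in the paper, with increments $\tau_1,\ldots,\tau_{k-1}$ also in the first $k-1$ variables.) Partial derivatives of $L$ are with respect to its named variables and are evaluated at $[y](\cdot)$; those of $l$ are evaluated at $\{y\}(\cdot)$. An expression such as ${_xD_b^\alpha}(\phi(x))$ means the operator applied to the function $\phi$, evaluated at $x$. *)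

theory Defs
  imports "HOL-Analysis.Analysis"
begin

text \<open>
  All integrals are Lebesgue integrals. A function on \<open>[a, b]\<close> is represented by a function
  \<open>real \<Rightarrow> real\<close>; its values outside \<open>[a, b]\<close> play no role below.
\<close>

section \<open>Absolutely continuous functions\<close>

text \<open>
  A set \<open>d\<close> with \<open>d division_of \<Union>d\<close> is a finite family of compact intervals with pairwise
  disjoint interiors, so this is the usual \<open>\<epsilon>\<close>-\<open>\<delta>\<close> definition.
\<close>

definition abs_continuous_on :: "real set \<Rightarrow> (real \<Rightarrow> real) \<Rightarrow> bool" where
  "abs_continuous_on S f \<longleftrightarrow>
     (\<forall>\<epsilon>>0. \<exists>\<delta>>0. \<forall>d. d division_of \<Union>d \<and> \<Union>d \<subseteq> S \<and> (\<Sum>k\<in>d. Sup k - Inf k) < \<delta> \<longrightarrow>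
        (\<Sum>k\<in>d. \<bar>f (Sup k) - f (Inf k)\<bar>) < \<epsilon>)"


section \<open>Fractional operators\<close>

definition rl_int_left :: "real \<Rightarrow> real \<Rightarrow> (real \<Rightarrow> real) \<Rightarrow> real \<Rightarrow> real" where
  "rl_int_left a \<gamma> f x = 1 / Gamma \<gamma> * (LINT t:{a..x}|lebesgue. (x - t) powr (\<gamma> - 1) * f t)"

definition rl_int_left_exists :: "real \<Rightarrow> real \<Rightarrow> (real \<Rightarrow> real) \<Rightarrow> real \<Rightarrow> bool" where
  "rl_int_left_exists a \<gamma> f x \<longleftrightarrow>
     set_integrable lebesgue {a..x} (\<lambda>t. (x - t) powr (\<gamma> - 1) * f t)"

definition rl_int_right :: "real \<Rightarrow> real \<Rightarrow> (real \<Rightarrow> real) \<Rightarrow> real \<Rightarrow> real" where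
  "rl_int_right b \<gamma> f x = 1 / Gamma \<gamma> * (LINT t:{x..b}|lebesgue. (t - x) powr (\<gamma> - 1) * f t)"

text \<open>
  The derivative is taken relative to \<open>[a, b]\<close>, i.e. it is one-sided at the end points. This is
  the only purpose of the parameter \<open>a\<close>.
\<close>

definition rl_deriv_right :: "real \<Rightarrow> real \<Rightarrow> real \<Rightarrow> (real \<Rightarrow> real) \<Rightarrow> real \<Rightarrow> real" where
  "rl_deriv_right a b \<alpha> f x =
     - 1 / Gamma (1 - \<alpha>) *
       vector_derivative (\<lambda>u. LINT t:{u..b}|lebesgue. (t - u) powr (- \<alpha>) * f t) (at x within {a..b})"

definition rl_deriv_right_exists :: "real \<Rightarrow> real \<Rightarrow> real \<Rightarrow> (real \<Rightarrow> real) \<Rightarrow> real \<Rightarrow> bool" where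
  "rl_deriv_right_exists a b \<alpha> f x \<longleftrightarrow>
     (\<forall>u\<in>{a..b}. set_integrable lebesgue {u..b} (\<lambda>t. (t - u) powr (- \<alpha>) * f t)) \<and>
     (\<lambda>u. LINT t:{u..b}|lebesgue. (t - u) powr (- \<alpha>) * f t) differentiable (at x within {a..b})"

text \<open>
  For absolutely continuous \<open>f\<close> the derivative exists almost everywhere, and the values of
  \<open>deriv f\<close> on the exceptional null set do not affect the integral.
\<close>

definition caputo_left :: "real \<Rightarrow> real \<Rightarrow> (real \<Rightarrow> real) \<Rightarrow> real \<Rightarrow> real" where
  "caputo_left a \<alpha> f x =
     1 / Gamma (1 - \<alpha>) * (LINT t:{a..x}|lebesgue. (x - t) powr (- \<alpha>) * deriv f t)"

definition caputo_left_exists :: "real \<Rightarrow> real \<Rightarrow> (real \<Rightarrow> real) \<Rightarrow> real \<Rightarrow> bool" where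
  "caputo_left_exists a \<alpha> f x \<longleftrightarrow>
     set_integrable lebesgue {a..x} (\<lambda>t. (x - t) powr (- \<alpha>) * deriv f t)"

definition admissible :: "real \<Rightarrow> real \<Rightarrow> real \<Rightarrow> real \<Rightarrow> (real \<Rightarrow> real) set" where
  "admissible a b \<alpha> \<beta> =
     {y. abs_continuous_on {a..b} y \<and>
         (\<forall>x\<in>{a..b}. caputo_left_exists a \<alpha> y x) \<and> continuous_on {a..b} (caputo_left a \<alpha> y) \<and>
         (\<forall>x\<in>{a..b}. rl_int_left_exists a \<beta> y x) \<and> continuous_on {a..b} (rl_int_left a \<beta> y)}"


section \<open>Partial derivatives, the class \<open>C\<^sup>1\<close>, and partial convexity\<close>

text \<open>
  Coordinates of a Euclidean space are named by the elements of \<open>Basis\<close>. Derivatives are relative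
  to the domain \<open>D\<close>, hence one-sided where \<open>D\<close> ends.
\<close>

definition partial_deriv :: "'a::euclidean_space set \<Rightarrow> ('a \<Rightarrow> real) \<Rightarrow> 'a \<Rightarrow> 'a \<Rightarrow> real" where
  "partial_deriv D \<Psi> i p =
     vector_derivative (\<lambda>s. \<Psi> (p + s *\<^sub>R i)) (at 0 within {s. p + s *\<^sub>R i \<in> D})"

definition partial_deriv_exists :: "'a::euclidean_space set \<Rightarrow> ('a \<Rightarrow> real) \<Rightarrow> 'a \<Rightarrow> 'a \<Rightarrow> bool" where
  "partial_deriv_exists D \<Psi> i p \<longleftrightarrow>
     (\<lambda>s. \<Psi> (p + s *\<^sub>R i)) differentiable (at 0 within {s. p + s *\<^sub>R i \<in> D})"

definition C1_on :: "'a::euclidean_space set \<Rightarrow> ('a \<Rightarrow> real) \<Rightarrow> bool" where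
  "C1_on D \<Psi> \<longleftrightarrow>
     (\<exists>\<Psi>' :: 'a \<Rightarrow> 'a \<Rightarrow>\<^sub>L real. continuous_on D \<Psi>' \<and>
        (\<forall>p\<in>D. (\<Psi> has_derivative blinfun_apply (\<Psi>' p)) (at p within D)))"

text \<open>
  Convexity in the coordinates \<open>I\<close>. Note that the increment \<open>\<tau>\<close> is not restricted to the span of
  \<open>I\<close>: the remaining coordinates may vary too, although only the partial derivatives in the
  directions \<open>I\<close> occur on the right-hand side.
\<close>

definition convex_in :: "'a::euclidean_space set \<Rightarrow> 'a set \<Rightarrow> ('a \<Rightarrow> real) \<Rightarrow> bool" where
  "convex_in I D \<Psi> \<longleftrightarrow>
     (\<forall>i\<in>I. (\<forall>p\<in>D. partial_deriv_exists D \<Psi> i p) \<and> continuous_on D (partial_deriv D \<Psi> i)) \<and>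
     (\<forall>p \<tau>. p \<in> D \<and> p + \<tau> \<in> D \<longrightarrow>
        \<Psi> (p + \<tau>) - \<Psi> p \<ge> (\<Sum>i\<in>I. partial_deriv D \<Psi> i p * (\<tau> \<bullet> i)))"

definition concave_in :: "'a::euclidean_space set \<Rightarrow> 'a set \<Rightarrow> ('a \<Rightarrow> real) \<Rightarrow> bool" where
  "concave_in I D \<Psi> \<longleftrightarrow>
     (\<forall>i\<in>I. (\<forall>p\<in>D. partial_deriv_exists D \<Psi> i p) \<and> continuous_on D (partial_deriv D \<Psi> i)) \<and>
     (\<forall>p \<tau>. p \<in> D \<and> p + \<tau> \<in> D \<longrightarrow>
        \<Psi> (p + \<tau>) - \<Psi> p \<le> (\<Sum>i\<in>I. partial_deriv D \<Psi> i p * (\<tau> \<bullet> i)))"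


section \<open>The variational problem\<close>

text \<open>
  \<open>L\<close> takes the tuple \<open>(x, y, v, w, z)\<close> and \<open>l\<close> the tuple \<open>(x, y, v, w)\<close>; the domains are
  \<open>[a, b] \<times> \<real>\<^sup>4\<close> and \<open>[a, b] \<times> \<real>\<^sup>3\<close>, both instances of \<open>dom_on a b\<close>.
\<close>

type_synonym arg4 = "real \<times> real \<times> real \<times> real"
type_synonym arg5 = "real \<times> real \<times> real \<times> real \<times> real"

definition dom_on :: "real \<Rightarrow> real \<Rightarrow> (real \<times> 'a) set" where
  "dom_on a b = {a..b} \<times> UNIV"

text \<open>The coordinate directions of \<open>y, v, w, z\<close> for \<open>L\<close>, and of \<open>y, v, w\<close> for \<open>l\<close>.\<close>

definition Ly :: arg5 where "Ly = (0, 1, 0, 0, 0)"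
definition Lv :: arg5 where "Lv = (0, 0, 1, 0, 0)"
definition Lw :: arg5 where "Lw = (0, 0, 0, 1, 0)"
definition Lz :: arg5 where "Lz = (0, 0, 0, 0, 1)"

definition ly :: arg4 where "ly = (0, 1, 0, 0)"
definition lv :: arg4 where "lv = (0, 0, 1, 0)"
definition lw :: arg4 where "lw = (0, 0, 0, 1)"

text \<open>\<open>state4\<close> is \<open>{y}(x)\<close>, \<open>indef\<close> is \<open>z(x)\<close>, and \<open>state5\<close> is \<open>[y](x)\<close>.\<close>

definition state4 :: "real \<Rightarrow> real \<Rightarrow> real \<Rightarrow> (real \<Rightarrow> real) \<Rightarrow> real \<Rightarrow> arg4" where
  "state4 a \<alpha> \<beta> y x = (x, y x, caputo_left a \<alpha> y x, rl_int_left a \<beta> y x)"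

definition indef ::
  "real \<Rightarrow> real \<Rightarrow> real \<Rightarrow> (arg4 \<Rightarrow> real) \<Rightarrow> (real \<Rightarrow> real) \<Rightarrow> real \<Rightarrow> real" where
  "indef a \<alpha> \<beta> l y x = (LINT t:{a..x}|lebesgue. l (state4 a \<alpha> \<beta> y t))"

definition state5 ::
  "real \<Rightarrow> real \<Rightarrow> real \<Rightarrow> (arg4 \<Rightarrow> real) \<Rightarrow> (real \<Rightarrow> real) \<Rightarrow> real \<Rightarrow> arg5" where
  "state5 a \<alpha> \<beta> l y x =
     (x, y x, caputo_left a \<alpha> y x, rl_int_left a \<beta> y x, indef a \<alpha> \<beta> l y x)"

definition functional_J ::
  "real \<Rightarrow> real \<Rightarrow> real \<Rightarrow> real \<Rightarrow> (arg5 \<Rightarrow> real) \<Rightarrow> (arg4 \<Rightarrow> real) \<Rightarrow> (real \<Rightarrow> real) \<Rightarrow> real" where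
  "functional_J a b \<alpha> \<beta> L l y = (LINT x:{a..b}|lebesgue. L (state5 a \<alpha> \<beta> l y x))"

text \<open>Partial derivatives of \<open>L\<close> along \<open>[y]\<close> and of \<open>l\<close> along \<open>{y}\<close>.\<close>

definition dL ::
  "real \<Rightarrow> real \<Rightarrow> real \<Rightarrow> real \<Rightarrow> (arg5 \<Rightarrow> real) \<Rightarrow> (arg4 \<Rightarrow> real) \<Rightarrow> (real \<Rightarrow> real) \<Rightarrow>
     arg5 \<Rightarrow> real \<Rightarrow> real" where
  "dL a b \<alpha> \<beta> L l y i x = partial_deriv (dom_on a b) L i (state5 a \<alpha> \<beta> l y x)"

definition dl ::
  "real \<Rightarrow> real \<Rightarrow> real \<Rightarrow> real \<Rightarrow> (arg4 \<Rightarrow> real) \<Rightarrow> (real \<Rightarrow> real) \<Rightarrow> arg4 \<Rightarrow> real \<Rightarrow> real" where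
  "dl a b \<alpha> \<beta> l y i x = partial_deriv (dom_on a b) l i (state4 a \<alpha> \<beta> y x)"

definition tail_Lz ::
  "real \<Rightarrow> real \<Rightarrow> real \<Rightarrow> real \<Rightarrow> (arg5 \<Rightarrow> real) \<Rightarrow> (arg4 \<Rightarrow> real) \<Rightarrow> (real \<Rightarrow> real) \<Rightarrow>
     real \<Rightarrow> real" where
  "tail_Lz a b \<alpha> \<beta> L l y x = (LINT t:{x..b}|lebesgue. dL a b \<alpha> \<beta> L l y Lz t)"

text \<open>
  Being a solution includes that the two fractional derivatives in the equation exist. For
  admissible \<open>y\<close> and \<open>C\<^sup>1\<close> data all other terms are integrals of continuous functions against
  integrable kernels and exist automatically.
\<close>

definition euler_lagrange ::
  "real \<Rightarrow> real \<Rightarrow> real \<Rightarrow> real \<Rightarrow> (arg5 \<Rightarrow> real) \<Rightarrow> (arg4 \<Rightarrow> real) \<Rightarrow> (real \<Rightarrow> real) \<Rightarrow> bool" where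
  "euler_lagrange a b \<alpha> \<beta> L l y \<longleftrightarrow>
     (\<forall>x\<in>{a..b}.
        rl_deriv_right_exists a b \<alpha> (dL a b \<alpha> \<beta> L l y Lv) x \<and>
        rl_deriv_right_exists a b \<alpha> (\<lambda>s. tail_Lz a b \<alpha> \<beta> L l y s * dl a b \<alpha> \<beta> l y lv s) x \<and>
        dL a b \<alpha> \<beta> L l y Ly x
        + rl_deriv_right a b \<alpha> (dL a b \<alpha> \<beta> L l y Lv) x
        + rl_int_right b \<beta> (dL a b \<alpha> \<beta> L l y Lw) x
        + tail_Lz a b \<alpha> \<beta> L l y x * dl a b \<alpha> \<beta> l y ly x
        + rl_deriv_right a b \<alpha> (\<lambda>s. tail_Lz a b \<alpha> \<beta> L l y s * dl a b \<alpha> \<beta> l y lv s) x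
        + rl_int_right b \<beta> (\<lambda>s. tail_Lz a b \<alpha> \<beta> L l y s * dl a b \<alpha> \<beta> l y lw s) x = 0)"

definition natural_boundary ::
  "real \<Rightarrow> real \<Rightarrow> real \<Rightarrow> real \<Rightarrow> (arg5 \<Rightarrow> real) \<Rightarrow> (arg4 \<Rightarrow> real) \<Rightarrow> (real \<Rightarrow> real) \<Rightarrow> bool" where
  "natural_boundary a b \<alpha> \<beta> L l y \<longleftrightarrow>
     rl_int_right b (1 - \<alpha>)
       (\<lambda>x. dL a b \<alpha> \<beta> L l y Lv x + tail_Lz a b \<alpha> \<beta> L l y x * dl a b \<alpha> \<beta> l y lv x) a = 0"

end

theory Submission
  imports Defs
begin

text \<open>
  Write \<open>T x\<close> for the integral of \<open>\<partial>L/\<partial>z\<close> over \<open>[x, b]\<close>. Convexity of \<open>L\<close> bounds \<open>J u - J y\<close> from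
  below by the integral of its first-order part. By Fubini the \<open>z\<close>-term of that part is the
  integral of the increment of \<open>l\<close> against \<open>T\<close>, which has the sign of \<open>\<partial>L/\<partial>z\<close>; convexity or concavity
  of \<open>l\<close> then reduces it to a first-order part as well. What remains is linear in \<open>u - y\<close>, and it
  vanishes by fractional integration by parts, the Euler-Lagrange equation and the natural boundary
  condition.

  Fractional integration by parts for the Caputo derivative needs that an absolutely continuous
  function is the integral of its almost everywhere derivative. For this, write the function as
  a difference of increasing absolutely continuous functions. The Stieltjes measures of these have
  densities by Radon-Nikodym, and the Lebesgue differentiation theorem identifies the difference
  of the densities with the derivative.
\<close>

section \<open>Absolutely continuous functions are integrals of their derivatives\<close>

lemma abs_continuous_onD:
  assumes "abs_continuous_on S f" "\<epsilon> > 0"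
  obtains \<delta> where "\<delta> > 0"
    "\<And>d. d division_of \<Union>d \<Longrightarrow> \<Union>d \<subseteq> S \<Longrightarrow> (\<Sum>k\<in>d. Sup k - Inf k) < \<delta> \<Longrightarrow>
        (\<Sum>k\<in>d. \<bar>f (Sup k) - f (Inf k)\<bar>) < \<epsilon>"
  using assms unfolding abs_continuous_on_def by meson

lemma division_of_Union_real_elem:
  fixes d :: "real set set"
  assumes "d division_of \<Union>d" "k \<in> d"
  shows "k = {Inf k..Sup k}" "Inf k \<le> Sup k"
proof -
  obtain u v where k: "k = cbox u v" "k \<noteq> {}"
    using assms division_ofD(3,4) by metis
  then have "u \<le> v" by auto
  then show "k = {Inf k..Sup k}" "Inf k \<le> Sup k"
    using k by auto
qed

lemma abs_continuous_on_imp_continuous_on: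
  assumes "abs_continuous_on {a..b} f"
  shows "continuous_on {a..b} f"
proof (rule continuous_on_iff[THEN iffD2, rule_format])
  fix x e :: real assume x: "x \<in> {a..b}" and "e > 0"
  obtain \<delta> where \<delta>: "\<delta> > 0"
    and *: "\<And>d. d division_of \<Union>d \<Longrightarrow> \<Union>d \<subseteq> {a..b} \<Longrightarrow> (\<Sum>k\<in>d. Sup k - Inf k) < \<delta> \<Longrightarrow>
        (\<Sum>k\<in>d. \<bar>f (Sup k) - f (Inf k)\<bar>) < e"
    using abs_continuous_onD[OF assms \<open>e > 0\<close>] by blast
  have "dist (f x') (f x) < e" if "x' \<in> {a..b}" "dist x' x < \<delta>" for x'
  proof -
    let ?u = "min x x'" and ?v = "max x x'"
    have "{cbox ?u ?v} division_of \<Union>{cbox ?u ?v}"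
      using division_of_self[of ?u ?v] by (auto simp: min_def max_def split: if_splits)
    from *[OF this] x that have "\<bar>f ?v - f ?u\<bar> < e"
      by (auto simp: dist_real_def min_def max_def split: if_splits)
    then show ?thesis
      by (auto simp: dist_real_def min_def max_def abs_minus_commute split: if_splits)
  qed
  then show "\<exists>d>0. \<forall>x'\<in>{a..b}. dist x' x < d \<longrightarrow> dist (f x') (f x) < e"
    using \<delta> by blast
qed

lemma abs_continuous_on_diff:
  assumes "abs_continuous_on S f" "abs_continuous_on S g"
  shows "abs_continuous_on S (\<lambda>x. f x - g x)"
  unfolding abs_continuous_on_def
proof (intro allI impI)
  fix e :: real assume "e > 0"
  obtain \<delta>1 where \<delta>1: "\<delta>1 > 0"
    "\<And>d. d division_of \<Union>d \<Longrightarrow> \<Union>d \<subseteq> S \<Longrightarrow> (\<Sum>k\<in>d. Sup k - Inf k) < \<delta>1 \<Longrightarrow>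
        (\<Sum>k\<in>d. \<bar>f (Sup k) - f (Inf k)\<bar>) < e/2"
    using abs_continuous_onD[OF assms(1) half_gt_zero[OF \<open>e > 0\<close>]] by blast
  obtain \<delta>2 where \<delta>2: "\<delta>2 > 0"
    "\<And>d. d division_of \<Union>d \<Longrightarrow> \<Union>d \<subseteq> S \<Longrightarrow> (\<Sum>k\<in>d. Sup k - Inf k) < \<delta>2 \<Longrightarrow>
        (\<Sum>k\<in>d. \<bar>g (Sup k) - g (Inf k)\<bar>) < e/2"
    using abs_continuous_onD[OF assms(2) half_gt_zero[OF \<open>e > 0\<close>]] by blast
  show "\<exists>\<delta>>0. \<forall>d. d division_of \<Union>d \<and> \<Union>d \<subseteq> S \<and> (\<Sum>k\<in>d. Sup k - Inf k) < \<delta> \<longrightarrow>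
        (\<Sum>k\<in>d. \<bar>f (Sup k) - g (Sup k) - (f (Inf k) - g (Inf k))\<bar>) < e"
  proof (intro exI[of _ "min \<delta>1 \<delta>2"] conjI allI impI)
    fix d assume d: "d division_of \<Union>d \<and> \<Union>d \<subseteq> S \<and> (\<Sum>k\<in>d. Sup k - Inf k) < min \<delta>1 \<delta>2"
    have "(\<Sum>k\<in>d. \<bar>f (Sup k) - g (Sup k) - (f (Inf k) - g (Inf k))\<bar>)
      \<le> (\<Sum>k\<in>d. \<bar>f (Sup k) - f (Inf k)\<bar> + \<bar>g (Sup k) - g (Inf k)\<bar>)"
      by (rule sum_mono) linarith
    also have "\<dots> < e/2 + e/2"
      unfolding sum.distrib using \<delta>1(2)[of d] \<delta>2(2)[of d] d by (intro add_strict_mono) auto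
    finally show "(\<Sum>k\<in>d. \<bar>f (Sup k) - g (Sup k) - (f (Inf k) - g (Inf k))\<bar>) < e" by simp
  qed (use \<delta>1 \<delta>2 in auto)
qed

text \<open>
  \<open>chain_sum f x y s\<close>: \<open>s\<close> is the sum of the increments \<open>\<bar>f x\<^sub>i - f x\<^sub>i\<^sub>-\<^sub>1\<bar>\<close> along some subdivision of
  \<open>[x, y]\<close>. Unlike sets of intervals, such chains are concatenated and split at a point by a plain
  rule induction.
\<close>

inductive chain_sum :: "(real \<Rightarrow> real) \<Rightarrow> real \<Rightarrow> real \<Rightarrow> real \<Rightarrow> bool" for f x where
  chain_refl: "chain_sum f x x 0"
| chain_step: "chain_sum f x y s \<Longrightarrow> y < z \<Longrightarrow> chain_sum f x z (s + \<bar>f z - f y\<bar>)"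

lemma chain_sum_le: "chain_sum f x y s \<Longrightarrow> x \<le> y"
  by (induction rule: chain_sum.induct) auto

lemma chain_sum_single: "x \<le> y \<Longrightarrow> chain_sum f x y \<bar>f y - f x\<bar>"
  using chain_sum.chain_step[OF chain_sum.chain_refl, of x y f] chain_sum.chain_refl[of f x]
  by (cases "x = y") auto

lemma chain_sum_trans:
  assumes "chain_sum f y z t" "chain_sum f x y s"
  shows "chain_sum f x z (s + t)"
  using assms
proof (induction rule: chain_sum.induct)
  case (chain_step w t z)
  from chain_sum.chain_step[OF chain_step.IH[OF chain_step.prems] chain_step.hyps(2)] show ?case
    by (simp add: add.assoc)
qed simp

text \<open>Refining a chain at \<open>c\<close> cannot decrease its sum, by the triangle
  inequality; hence an inequality and not an equation. If \<open>c\<close> lies before the last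
  step, the shorter chain is split; otherwise \<open>c\<close> cuts the last step itself.\<close>

lemma chain_sum_split:
  assumes "chain_sum f x z s" "x \<le> c" "c \<le> z"
  shows "\<exists>s1 s2. chain_sum f x c s1 \<and> chain_sum f c z s2 \<and> s \<le> s1 + s2"
  using assms
proof (induction rule: chain_sum.induct)
  case chain_refl
  then have "c = x" by simp
  then show ?case using chain_sum.chain_refl[of f x] by (intro exI[of _ 0]) simp
next
  case (chain_step y s z)
  show ?case
  proof (cases "c \<le> y")
    case True
    with chain_step obtain s1 s2 where s: "chain_sum f x c s1" "chain_sum f c y s2" "s \<le> s1 + s2"
      by blast
    show ?thesis
      by (rule exI[of _ s1], rule exI[of _ "s2 + \<bar>f z - f y\<bar>"])
        (use s chain_sum.chain_step[OF s(2) chain_step.hyps(2)] in auto)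
  next
    case False
    then have "y < c" by simp
    show ?thesis
      by (rule exI[of _ "s + \<bar>f c - f y\<bar>"], rule exI[of _ "\<bar>f z - f c\<bar>"])
        (use chain_sum.chain_step[OF chain_step.hyps(1) \<open>y < c\<close>] chain_sum_single[OF chain_step.prems(2), of f] in auto)
  qed
qed

text \<open>This links chains to the divisions in \<open>abs_continuous_on\<close>. The nonempty
  interiors are recorded so that divisions of different nonoverlapping intervals share no
  member.\<close>

lemma chain_sum_division:
  assumes "chain_sum f x y s"
  shows "\<exists>d. d division_of \<Union>d \<and> \<Union>d \<subseteq> {x..y} \<and> (\<forall>k\<in>d. interior k \<noteq> {}) \<and>
     (\<Sum>k\<in>d. \<bar>f (Sup k) - f (Inf k)\<bar>) = s \<and> (\<Sum>k\<in>d. Sup k - Inf k) = y - x"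
  using assms
proof (induction rule: chain_sum.induct)
  case chain_refl
  show ?case by (intro exI[of _ "{}"]) auto
next
  case (chain_step y s z)
  then obtain d where d: "d division_of \<Union>d" "\<Union>d \<subseteq> {x..y}" "\<forall>k\<in>d. interior k \<noteq> {}"
    "(\<Sum>k\<in>d. \<bar>f (Sup k) - f (Inf k)\<bar>) = s" "(\<Sum>k\<in>d. Sup k - Inf k) = y - x"
    by blast
  have xy: "x \<le> y" by (rule chain_sum_le[OF chain_step.hyps(1)])
  have disj: "interior k \<inter> interior {y..z} = {}" if "k \<in> d" for k
  proof -
    have "k \<subseteq> {x..y}" using that d by auto
    then have "interior k \<subseteq> {x<..<y}" by (metis interior_atLeastAtMost_real interior_mono)
    then show ?thesis by auto
  qed
  \<comment> \<open>A division is a set, so the sums gain a term only if the new interval is really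
    new. It has nonempty interior because steps of a chain are strict.\<close>
  have nin: "{y..z} \<notin> d"
    using disj[of "{y..z}"] chain_step.hyps(2) by auto
  have fin: "finite d" using d by blast
  have "insert {y..z} d division_of \<Union>(insert {y..z} d)"
  proof (rule division_ofI)
    show "finite (insert {y..z} d)" using fin by simp
    fix k assume k: "k \<in> insert {y..z} d"
    then show "k \<subseteq> \<Union>(insert {y..z} d)" by blast
    show "k \<noteq> {}" using k division_ofD(3)[OF d(1)] chain_step.hyps(2) by auto
    show "\<exists>a b. k = cbox a b" using k division_ofD(4)[OF d(1)] by (metis cbox_interval insertE)
    fix k' assume "k' \<in> insert {y..z} d" "k \<noteq> k'"
    then show "interior k \<inter> interior k' = {}"
      using k disj division_ofD(5)[OF d(1)] by (metis inf_commute insertE)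
  qed simp
  moreover have "\<Union>(insert {y..z} d) \<subseteq> {x..z}"
    using d(2) xy chain_step.hyps(2) by fastforce
  moreover have "\<forall>k\<in>insert {y..z} d. interior k \<noteq> {}"
    using d(3) chain_step.hyps(2) by simp
  moreover have "(\<Sum>k\<in>insert {y..z} d. \<bar>f (Sup k) - f (Inf k)\<bar>) = s + \<bar>f z - f y\<bar>"
    using d(4) nin fin chain_step.hyps(2) by simp
  moreover have "(\<Sum>k\<in>insert {y..z} d. Sup k - Inf k) = z - x"
    using d(5) nin fin chain_step.hyps(2) by simp
  ultimately show ?case by blast
qed

section \<open>Total variation and the decomposition into increasing functions\<close>

text \<open>This is the total variation of \<open>f\<close> on \<open>[x, y]\<close>. The supremum
  is meaningful only for a bounded set of sums, which absolute continuity will provide.\<close>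

definition chain_var :: "(real \<Rightarrow> real) \<Rightarrow> real \<Rightarrow> real \<Rightarrow> real" where
  "chain_var f x y = Sup {s. chain_sum f x y s}"

text \<open>Induction on the number of pieces: split off an initial piece of length at most
  \<open>\<delta>\<close>, which contributes at most 1, and apply the hypothesis to the
  rest.\<close>

lemma chain_sum_bounded_steps:
  assumes bnd: "\<And>x y s. a \<le> x \<Longrightarrow> y \<le> b \<Longrightarrow> y - x \<le> \<delta> \<Longrightarrow> chain_sum f x y s \<Longrightarrow> s \<le> 1"
    and "\<delta> > 0"
  shows "a \<le> x \<Longrightarrow> y \<le> b \<Longrightarrow> y - x \<le> real n * \<delta> \<Longrightarrow> chain_sum f x y s \<Longrightarrow> s \<le> real n"
proof (induction n arbitrary: x s)
  case 0
  then have "x = y" using chain_sum_le by force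
  \<comment> \<open>Strictness of the steps leaves only the empty chain from a point to
    itself.\<close>
  show ?case using 0(4) unfolding \<open>x = y\<close> using \<open>x = y\<close>
    by (cases rule: chain_sum.cases) (use chain_sum_le in force)+
next
  case (Suc n)
  have xy: "x \<le> y" using Suc.prems chain_sum_le by blast
  define c where "c = min y (x + \<delta>)"
  have c: "x \<le> c" "c \<le> y" "c - x \<le> \<delta>" "y - c \<le> real n * \<delta>"
    using xy Suc.prems(3) \<open>\<delta> > 0\<close> by (auto simp: c_def min_def algebra_simps)
  obtain s1 s2 where s: "chain_sum f x c s1" "chain_sum f c y s2" "s \<le> s1 + s2"
    using chain_sum_split[OF Suc.prems(4) c(1,2)] by blast
  have "s1 \<le> 1" using bnd[OF _ _ c(3) s(1)] c Suc.prems by auto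
  moreover have "s2 \<le> real n" using Suc.IH[OF _ _ c(4) s(2)] c Suc.prems by auto
  ultimately show ?case using s by auto
qed

text \<open>Absolute continuity with \<open>\<epsilon> = 1\<close> bounds the variation over short
  intervals, and finitely many of these exhaust \<open>[x, y]\<close>.\<close>

lemma abs_continuous_on_bdd_chain_sum:
  assumes "abs_continuous_on {a..b} f" "a \<le> x" "y \<le> b"
  shows "bdd_above {s. chain_sum f x y s}"
proof -
  obtain \<delta> where \<delta>: "\<delta> > 0"
    and *: "\<And>d. d division_of \<Union>d \<Longrightarrow> \<Union>d \<subseteq> {a..b} \<Longrightarrow> (\<Sum>k\<in>d. Sup k - Inf k) < \<delta> \<Longrightarrow>
        (\<Sum>k\<in>d. \<bar>f (Sup k) - f (Inf k)\<bar>) < 1"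
    using abs_continuous_onD[OF assms(1) zero_less_one] by blast
  \<comment> \<open>Half of \<open>\<delta>\<close> turns the strict length condition of absolute
    continuity into a non-strict one, as \<open>chain_sum_bounded_steps\<close> requires.\<close>
  have small: "s \<le> 1" if xy: "a \<le> x" "y \<le> b" "y - x \<le> \<delta>/2" "chain_sum f x y s" for x y s
  proof -
    obtain d where d: "d division_of \<Union>d" "\<Union>d \<subseteq> {x..y}"
      "(\<Sum>k\<in>d. \<bar>f (Sup k) - f (Inf k)\<bar>) = s" "(\<Sum>k\<in>d. Sup k - Inf k) = y - x"
      using chain_sum_division[OF xy(4)] by blast
    moreover have "\<Union>d \<subseteq> {a..b}" using d(2) xy(1,2) by (meson order_trans atLeastatMost_subset_iff)
    ultimately show ?thesis using *[of d] xy(3) \<delta> by auto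
  qed
  obtain n where n: "(y - x) / (\<delta>/2) \<le> real n" using real_arch_simple by blast
  then have n: "y - x \<le> real n * (\<delta>/2)" using \<delta> by (simp add: field_simps)
  have "s \<le> real n" if "chain_sum f x y s" for s
    by (rule chain_sum_bounded_steps[where a=a and b=b and \<delta>="\<delta>/2" and f=f, OF small])
      (use assms(2,3) \<delta> n that in auto)
  then show ?thesis by (auto simp: bdd_above_def)
qed

lemma chain_sum_le_chain_var:
  assumes "abs_continuous_on {a..b} f" "a \<le> x" "y \<le> b" "chain_sum f x y s"
  shows "s \<le> chain_var f x y"
  unfolding chain_var_def
  by (rule cSup_upper) (use assms abs_continuous_on_bdd_chain_sum[OF assms(1-3)] in auto)

lemma chain_var_approx:
  assumes "x \<le> y" "e > 0"
  obtains s where "chain_sum f x y s" "chain_var f x y - e < s"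
proof -
  have "{s. chain_sum f x y s} \<noteq> {}" using chain_sum_single[OF assms(1)] by blast
  then show ?thesis
    using less_cSupE[of "chain_var f x y - e" "{s. chain_sum f x y s}"] assms that
    unfolding chain_var_def by auto
qed

text \<open>Near-optimal chains over \<open>[x, y]\<close> are split at \<open>c\<close> for one
  inequality; near-optimal chains over the two halves are concatenated for the other.\<close>

lemma chain_var_add:
  assumes ac: "abs_continuous_on {a..b} f" and le: "a \<le> x" "x \<le> c" "c \<le> y" "y \<le> b"
  shows "chain_var f x y = chain_var f x c + chain_var f c y"
proof (rule antisym)
  show "chain_var f x y \<le> chain_var f x c + chain_var f c y"
  proof (rule field_le_epsilon)
    fix e :: real assume "e > 0"
    then obtain s where s: "chain_sum f x y s" "chain_var f x y - e < s"
      using chain_var_approx[of x y e f] le by auto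
    then obtain s1 s2 where "chain_sum f x c s1" "chain_sum f c y s2" "s \<le> s1 + s2"
      using chain_sum_split le by blast
    then have "s1 \<le> chain_var f x c" "s2 \<le> chain_var f c y" "s \<le> s1 + s2"
      using chain_sum_le_chain_var[OF ac] le by auto
    with s show "chain_var f x y \<le> chain_var f x c + chain_var f c y + e" by linarith
  qed
next
  show "chain_var f x c + chain_var f c y \<le> chain_var f x y"
  proof (rule field_le_epsilon)
    fix e :: real assume "e > 0"
    obtain s1 where s1: "chain_sum f x c s1" "chain_var f x c - e/2 < s1"
      using chain_var_approx[of x c "e/2" f] le \<open>e > 0\<close> by auto
    obtain s2 where s2: "chain_sum f c y s2" "chain_var f c y - e/2 < s2"
      using chain_var_approx[of c y "e/2" f] le \<open>e > 0\<close> by auto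
    have "s1 + s2 \<le> chain_var f x y"
      using chain_sum_le_chain_var[OF ac _ _ chain_sum_trans[OF s2(1) s1(1)]] le by auto
    with s1 s2 show "chain_var f x c + chain_var f c y \<le> chain_var f x y + e" by linarith
  qed
qed

lemma abs_diff_le_chain_var:
  assumes "abs_continuous_on {a..b} f" "a \<le> x" "x \<le> y" "y \<le> b"
  shows "\<bar>f y - f x\<bar> \<le> chain_var f x y"
  using chain_sum_le_chain_var[OF assms(1,2,4) chain_sum_single[OF assms(3)]] .

text \<open>Replace every interval of a given division by a near-optimal chain inside it. All pieces
  together form a finer division of the same total length, so the \<open>\<delta>\<close> that
  belongs to \<open>f\<close> and \<open>e/2\<close> still applies, and the defects from optimality
  add up to at most \<open>e/2\<close>.\<close>

lemma abs_continuous_on_chain_var: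
  assumes ac: "abs_continuous_on {a..b} f"
  shows "abs_continuous_on {a..b} (chain_var f a)"
  unfolding abs_continuous_on_def
proof (intro allI impI)
  fix e :: real assume "e > 0"
  obtain \<delta> where \<delta>: "\<delta> > 0"
    and *: "\<And>d. d division_of \<Union>d \<Longrightarrow> \<Union>d \<subseteq> {a..b} \<Longrightarrow> (\<Sum>k\<in>d. Sup k - Inf k) < \<delta> \<Longrightarrow>
        (\<Sum>k\<in>d. \<bar>f (Sup k) - f (Inf k)\<bar>) < e/2"
    using abs_continuous_onD[OF ac half_gt_zero[OF \<open>e > 0\<close>]] by blast
  show "\<exists>\<delta>>0. \<forall>D. D division_of \<Union>D \<and> \<Union>D \<subseteq> {a..b} \<and> (\<Sum>k\<in>D. Sup k - Inf k) < \<delta> \<longrightarrow>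
        (\<Sum>k\<in>D. \<bar>chain_var f a (Sup k) - chain_var f a (Inf k)\<bar>) < e"
  proof (intro exI[of _ \<delta>] conjI allI impI)
    fix D assume "D division_of \<Union>D \<and> \<Union>D \<subseteq> {a..b} \<and> (\<Sum>k\<in>D. Sup k - Inf k) < \<delta>"
    then have D: "D division_of \<Union>D" "\<Union>D \<subseteq> {a..b}" "(\<Sum>k\<in>D. Sup k - Inf k) < \<delta>" by auto
    have finD: "finite D" using D(1) by blast
    have K: "K = {Inf K..Sup K}" "Inf K \<le> Sup K" "a \<le> Inf K" "Sup K \<le> b" if "K \<in> D" for K
    proof -
      show 1: "K = {Inf K..Sup K}" and 2: "Inf K \<le> Sup K"
        using division_of_Union_real_elem[OF D(1) that] by auto
      have "{Inf K..Sup K} \<subseteq> {a..b}" using D(2) that 1 by blast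
      then show "a \<le> Inf K" "Sup K \<le> b" using 2 by auto
    qed
    \<comment> \<open>The defects sum to \<open>card D * \<eta>\<close>, at most \<open>e/2\<close>.
      The added 1 avoids division by zero for empty \<open>D\<close>.\<close>
    define \<eta> where "\<eta> = e / (2 * (real (card D) + 1))"
    have "\<eta> > 0" using \<open>e > 0\<close> by (simp add: \<eta>_def)
    have "\<exists>s. chain_sum f (Inf K) (Sup K) s \<and> chain_var f (Inf K) (Sup K) - \<eta> < s" if "K \<in> D" for K
      using chain_var_approx[OF K(2)[OF that] \<open>\<eta> > 0\<close>] by metis
    then obtain s where s: "\<And>K. K \<in> D \<Longrightarrow> chain_sum f (Inf K) (Sup K) (s K)"
      "\<And>K. K \<in> D \<Longrightarrow> chain_var f (Inf K) (Sup K) - \<eta> < s K" by metis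
    define Q where "Q = (\<lambda>K d. d division_of \<Union>d \<and> \<Union>d \<subseteq> {Inf K..Sup K} \<and> (\<forall>k\<in>d. interior k \<noteq> {}) \<and>
     (\<Sum>k\<in>d. \<bar>f (Sup k) - f (Inf k)\<bar>) = s K \<and> (\<Sum>k\<in>d. Sup k - Inf k) = Sup K - Inf K)"
    have "\<forall>K\<in>D. \<exists>d. Q K d"
      unfolding Q_def using chain_sum_division[OF s(1)] by blast
    then obtain d where "\<forall>K\<in>D. Q K (d K)" using bchoice by blast
    then have d: "\<And>K. K \<in> D \<Longrightarrow> d K division_of \<Union>(d K)"
      "\<And>K. K \<in> D \<Longrightarrow> \<Union>(d K) \<subseteq> {Inf K..Sup K}"
      "\<And>K k. K \<in> D \<Longrightarrow> k \<in> d K \<Longrightarrow> interior k \<noteq> {}"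
      "\<And>K. K \<in> D \<Longrightarrow> (\<Sum>k\<in>d K. \<bar>f (Sup k) - f (Inf k)\<bar>) = s K"
      "\<And>K. K \<in> D \<Longrightarrow> (\<Sum>k\<in>d K. Sup k - Inf k) = Sup K - Inf K"
      unfolding Q_def by blast+
    have kK: "k \<subseteq> K" if "K \<in> D" "k \<in> d K" for k K
      using d(2)[OF that(1)] that(2) K(1)[OF that(1)] by blast
    have finite: "\<And>K. K \<in> D \<Longrightarrow> finite (d K)" using d(1) by blast
    define E where "E = (\<Union>K\<in>D. d K)"
    have dis: "interior k1 \<inter> interior k2 = {}"
      if "K1 \<in> D" "K2 \<in> D" "K1 \<noteq> K2" "k1 \<in> d K1" "k2 \<in> d K2" for k1 k2 K1 K2
      using division_ofD(5)[OF D(1) that(1-3)] interior_mono[OF kK[OF that(1,4)]]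
        interior_mono[OF kK[OF that(2,5)]] by blast
    \<comment> \<open>A common member would have an interior disjoint from itself, hence empty,
      against the choice of \<open>d\<close>. Disjointness makes the sum over \<open>E\<close> an
      iterated sum.\<close>
    have dis': "d K1 \<inter> d K2 = {}" if "K1 \<in> D" "K2 \<in> D" "K1 \<noteq> K2" for K1 K2
      using dis[OF that] d(3) that(1) by blast
    have "E division_of \<Union>E"
    proof (rule division_ofI)
      show "finite E" using finD finite by (auto simp: E_def)
      fix k assume "k \<in> E"
      then obtain K1 where K1: "K1 \<in> D" "k \<in> d K1" by (auto simp: E_def)
      show "k \<subseteq> \<Union>E" using \<open>k \<in> E\<close> by blast
      show "k \<noteq> {}" using d(1)[OF K1(1)] K1(2) by blast
      show "\<exists>a b. k = cbox a b" using division_ofD(4)[OF d(1)[OF K1(1)] K1(2)] .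
      fix k' assume "k' \<in> E" "k \<noteq> k'"
      then obtain K2 where K2: "K2 \<in> D" "k' \<in> d K2" by (auto simp: E_def)
      show "interior k \<inter> interior k' = {}"
        using dis[OF K1(1) K2(1) _ K1(2) K2(2)] division_ofD(5)[OF d(1)[OF K1(1)] K1(2)] K2
          \<open>k \<noteq> k'\<close> by blast
    qed simp
    moreover have "\<Union>E \<subseteq> {a..b}" using kK D(2) unfolding E_def by blast
    moreover have sumE: "(\<Sum>k\<in>E. h k) = (\<Sum>K\<in>D. \<Sum>k\<in>d K. h k)" for h :: "real set \<Rightarrow> real"
      unfolding E_def by (rule sum.UNION_disjoint) (use finD finite dis' in auto)
    moreover have "(\<Sum>k\<in>E. Sup k - Inf k) < \<delta>"
      unfolding sumE using D(3) d(5) by simp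
    ultimately have "(\<Sum>K\<in>D. s K) < e/2"
      using *[of E] d(4) unfolding sumE by simp
    have "(\<Sum>K\<in>D. \<bar>chain_var f a (Sup K) - chain_var f a (Inf K)\<bar>) \<le> (\<Sum>K\<in>D. s K + \<eta>)"
    proof (rule sum_mono)
      fix K assume "K \<in> D"
      note K = K[OF this] and s = s[OF this]
      have "chain_var f a (Sup K) = chain_var f a (Inf K) + chain_var f (Inf K) (Sup K)"
        using chain_var_add[OF ac, of a "Inf K" "Sup K"] K(2,3,4) by auto
      moreover have "0 \<le> chain_var f (Inf K) (Sup K)"
        using abs_diff_le_chain_var[OF ac K(3,2,4)] by linarith
      ultimately show "\<bar>chain_var f a (Sup K) - chain_var f a (Inf K)\<bar> \<le> s K + \<eta>"
        using s(2) by linarith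
    qed
    also have "\<dots> = (\<Sum>K\<in>D. s K) + card D * \<eta>" by (simp add: sum.distrib)
    also have "\<dots> < e/2 + e/2"
    proof -
      have "card D * \<eta> \<le> e/2" using \<open>e > 0\<close> by (simp add: \<eta>_def field_simps)
      then show ?thesis using \<open>(\<Sum>K\<in>D. s K) < e/2\<close> by linarith
    qed
    finally show "(\<Sum>K\<in>D. \<bar>chain_var f a (Sup K) - chain_var f a (Inf K)\<bar>) < e" by simp
  qed (rule \<delta>)
qed

text \<open>Jordan decomposition into the variation \<open>V\<close> and \<open>V - f\<close>: an
  increment of \<open>V\<close> dominates the absolute value of the increment of \<open>f\<close>,
  so both are increasing.\<close>

lemma abs_continuous_on_decompose_mono:
  assumes ac: "abs_continuous_on {a..b} f"
  obtains F G where "abs_continuous_on {a..b} F" "abs_continuous_on {a..b} G"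
    "mono_on {a..b} F" "mono_on {a..b} G" "\<And>x. f x = F x - G x"
proof
  let ?V = "chain_var f a"
  show "abs_continuous_on {a..b} ?V" by (rule abs_continuous_on_chain_var[OF ac])
  show "abs_continuous_on {a..b} (\<lambda>x. ?V x - f x)"
    by (rule abs_continuous_on_diff[OF abs_continuous_on_chain_var[OF ac] ac])
  have *: "?V x \<le> ?V y \<and> ?V x - f x \<le> ?V y - f y" if "x \<in> {a..b}" "y \<in> {a..b}" "x \<le> y" for x y
  proof -
    have "?V y = ?V x + chain_var f x y"
      using chain_var_add[OF ac, of a x y] that by auto
    moreover have "\<bar>f y - f x\<bar> \<le> chain_var f x y"
      using abs_diff_le_chain_var[OF ac] that by auto
    ultimately show ?thesis by linarith
  qed
  show "mono_on {a..b} ?V" "mono_on {a..b} (\<lambda>x. ?V x - f x)"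
    using * by (auto intro!: mono_onI)
qed simp

section \<open>Stieltjes measures and their densities\<close>

lemma set_integrable_if_integrable:
  fixes f :: "'a \<Rightarrow> real"
  assumes "integrable M f" "S \<in> sets M"
  shows "set_integrable M S f"
  unfolding set_integrable_def using integrable_mult_indicator[OF assms(2,1)] .

text \<open>Cover \<open>N\<close> by countably many nonoverlapping intervals inside an open set of
  Lebesgue measure below \<open>\<delta>\<close>. Absolute continuity bounds the Stieltjes measure
  of each finite subfamily by \<open>e\<close>, and continuity from below extends the bound to the
  whole cover.\<close>

lemma interval_measure_null_if_abs_continuous:
  fixes F :: "real \<Rightarrow> real"
  assumes "a < b" and mono: "mono F" and cont: "continuous_on UNIV F"
    and ac: "abs_continuous_on {a..b} F"
    and N: "N \<in> null_sets lborel" "N \<subseteq> {a..b}"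
  shows "emeasure (interval_measure F) N = 0"
proof -
  let ?M = "interval_measure F"
  have Nb: "N \<in> sets borel" using N by auto
  have em: "emeasure ?M {u..v} = ennreal (F v - F u)" if "u \<le> v" for u v
    by (rule emeasure_interval_measure_Icc[OF that _ cont]) (use mono in \<open>auto dest: monoD\<close>)
  have "emeasure ?M N \<le> ennreal e" if "e > 0" for e
  proof -
    obtain \<delta> where \<delta>: "\<delta> > 0"
      and *: "\<And>d. d division_of \<Union>d \<Longrightarrow> \<Union>d \<subseteq> {a..b} \<Longrightarrow> (\<Sum>k\<in>d. Sup k - Inf k) < \<delta> \<Longrightarrow>
        (\<Sum>k\<in>d. \<bar>F (Sup k) - F (Inf k)\<bar>) < e"
      using abs_continuous_onD[OF ac \<open>e > 0\<close>] by blast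
    obtain U where U: "open U" "N \<subseteq> U" "emeasure lborel (U - N) < ennreal \<delta>"
      using outer_regular_lborel[OF Nb \<delta>] by blast
    have "emeasure lborel U = emeasure lborel (U - N)"
      using emeasure_Diff_null_set[of N lborel U] N(1) U(1) by simp
    with U have Ud: "emeasure lborel U < ennreal \<delta>" by simp
    \<comment> \<open>With this gauge an interval of the covering that meets \<open>N\<close> at its
      tag must lie in \<open>U\<close>, since \<open>N\<close> lies in \<open>U\<close>.\<close>
    define \<gamma> where "\<gamma> = (\<lambda>x. if x \<in> U then U else UNIV)"
    have "gauge \<gamma>" using U by (auto simp: gauge_def \<gamma>_def)
    moreover have "N \<subseteq> cbox a b" "box a b \<noteq> {}" using N \<open>a < b\<close> by auto
    ultimately obtain D where D: "countable D" "\<Union>D \<subseteq> cbox a b"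
      "\<And>K. K \<in> D \<Longrightarrow> interior K \<noteq> {} \<and> (\<exists>c d. K = cbox c d)"
      "pairwise (\<lambda>A B. interior A \<inter> interior B = {}) D"
      "\<And>K. K \<in> D \<Longrightarrow> \<exists>x \<in> N \<inter> K. K \<subseteq> \<gamma> x"
      "N \<subseteq> \<Union>D"
      using covering_lemma[of N a b \<gamma>] by metis
    have K: "interior K = {Inf K<..<Sup K}" "Inf K < Sup K" "emeasure ?M K = ennreal (F (Sup K) - F (Inf K))"
      "K \<in> sets borel" "K \<subseteq> U" if "K \<in> D" for K
    proof -
      obtain c d where cd: "K = {c..d}" using D(3)[OF \<open>K \<in> D\<close>] by auto
      moreover have "c < d" using D(3)[OF \<open>K \<in> D\<close>] unfolding cd by auto
      ultimately show "interior K = {Inf K<..<Sup K}" "Inf K < Sup K" "K \<in> sets borel"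
        "emeasure ?M K = ennreal (F (Sup K) - F (Inf K))"
        using em[of c d] by auto
      show "K \<subseteq> U" using D(5)[OF \<open>K \<in> D\<close>] U(2) by (auto simp: \<gamma>_def split: if_splits)
    qed
    have fin: "emeasure ?M (\<Union>E) \<le> ennreal e" if E: "finite E" "E \<subseteq> D" for E
    proof -
      have "E division_of \<Union>E"
      proof (rule division_ofI)
        fix k assume k: "k \<in> E"
        show "\<exists>a b. k = cbox a b" "k \<noteq> {}" using D(3)[of k] k E by auto
        fix k' assume "k' \<in> E" "k \<noteq> k'"
        then show "interior k \<inter> interior k' = {}"
          using D(4) k E by (auto simp: pairwise_def)
      qed (use E in auto)
      moreover have "\<Union>E \<subseteq> {a..b}" using D(2) E by auto
      moreover have "(\<Sum>k\<in>E. Sup k - Inf k) < \<delta>"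
      proof -
        have "ennreal (\<Sum>k\<in>E. Sup k - Inf k) = (\<Sum>k\<in>E. ennreal (Sup k - Inf k))"
          by (rule sum_ennreal[symmetric]) (use K(2) E in \<open>auto intro: less_imp_le\<close>)
        \<comment> \<open>The closed intervals may share end points; their interiors are disjoint
          and have the same length, so the measures add.\<close>
        also have "\<dots> = (\<Sum>k\<in>E. emeasure lborel (interior k))"
          by (rule sum.cong) (use K(1,2) E in \<open>auto simp: subset_iff less_imp_le\<close>)
        also have "\<dots> = emeasure lborel (\<Union>k\<in>E. interior k)"
          by (rule sum_emeasure)
            (use E D(4) in \<open>auto simp: disjoint_family_on_def pairwise_def subset_iff\<close>)
        also have "\<dots> \<le> emeasure lborel U"
          by (rule emeasure_mono) (use K(5) E U interior_subset in \<open>fastforce+\<close>)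
        finally have "ennreal (\<Sum>k\<in>E. Sup k - Inf k) < ennreal \<delta>" using Ud by simp
        moreover have "0 \<le> (\<Sum>k\<in>E. Sup k - Inf k)"
          by (rule sum_nonneg) (use K(2) E in \<open>force intro: less_imp_le\<close>)
        ultimately show ?thesis by (simp add: ennreal_less_iff)
      qed
      ultimately have le: "(\<Sum>k\<in>E. \<bar>F (Sup k) - F (Inf k)\<bar>) < e" by (rule *)
      have "emeasure ?M (\<Union>E) \<le> (\<Sum>k\<in>E. emeasure ?M k)"
        using emeasure_subadditive_finite[of E "\<lambda>k. k" ?M] E K(4) by auto
      also have "\<dots> = (\<Sum>k\<in>E. ennreal \<bar>F (Sup k) - F (Inf k)\<bar>)"
      proof (rule sum.cong)
        fix k assume "k \<in> E"
        then have "k \<in> D" using E by auto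
        then have "F (Inf k) \<le> F (Sup k)" using monoD[OF mono] K(2) less_imp_le by metis
        then show "emeasure ?M k = ennreal \<bar>F (Sup k) - F (Inf k)\<bar>" using K(3)[OF \<open>k \<in> D\<close>] by simp
      qed simp
      also have "\<dots> = ennreal (\<Sum>k\<in>E. \<bar>F (Sup k) - F (Inf k)\<bar>)"
        by (rule sum_ennreal) auto
      also have "\<dots> \<le> ennreal e" using le by (simp add: ennreal_leI less_imp_le)
      finally show ?thesis .
    qed
    show ?thesis
    proof (cases "D = {}")
      case True then show ?thesis using D(6) by simp
    next
      case False
      \<comment> \<open>Unions of finite subfamilies increasing to the whole cover. For finite
        \<open>D\<close> the enumeration repeats members, which does not change the unions.\<close>
      define A where "A = (\<lambda>n::nat. \<Union>(from_nat_into D ` {..n}))"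
      have rD: "range (from_nat_into D) = D" by (rule range_from_nat_into[OF False D(1)])
      have sub: "from_nat_into D ` {..n} \<subseteq> D" for n using rD by blast
      have "(\<Union>n. A n) = \<Union>(range (from_nat_into D))" unfolding A_def by auto
      then have UA: "(\<Union>n. A n) = \<Union>D" unfolding rD .
      have inc: "incseq A" unfolding incseq_def A_def by (intro allI impI Union_mono image_mono) simp
      have "A n \<in> sets ?M" for n
        unfolding A_def using K(4) sub[of n] by (auto intro!: sets.finite_Union)
      then have rA: "range A \<subseteq> sets ?M" by auto
      have "(\<Union>n. A n) \<in> sets ?M" by (rule sets.countable_UN[OF rA])
      moreover have "N \<subseteq> (\<Union>n. A n)" unfolding UA by (rule D(6))
      ultimately have "emeasure ?M N \<le> emeasure ?M (\<Union>n. A n)"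
        by (rule emeasure_mono[rotated])
      also have "\<dots> = (SUP n. emeasure ?M (A n))"
        by (rule SUP_emeasure_incseq[OF rA inc, symmetric])
      also have "\<dots> \<le> ennreal e"
        by (rule SUP_least) (unfold A_def, rule fin, use sub in auto)
      finally show ?thesis .
    qed
  qed
  then have "emeasure ?M N \<le> 0 + ennreal e" if "e > 0" for e
    using that by simp
  then have "emeasure ?M N \<le> 0"
    by (rule ennreal_le_epsilon)
  then show ?thesis by simp
qed

text \<open>Absolute continuity of the function becomes absolute continuity of its Stieltjes measure
  with respect to Lebesgue measure, and Radon-Nikodym supplies the density.\<close>

lemma mono_abs_continuous_density:
  assumes "a < b" and mono: "mono_on {a..b} F" and ac: "abs_continuous_on {a..b} F"
  obtains g where "integrable lborel g" "\<And>x. x \<in> {a..b} \<Longrightarrow> (LBINT t:{a..x}. g t) = F x - F a"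
proof -
  \<comment> \<open>Stieltjes measures need a monotone continuous function on the whole line, so
    \<open>F\<close> is continued by its end values.\<close>
  define G where "G = (\<lambda>x. F (max a (min b x)))"
  have G: "G x = F x" if "x \<in> {a..b}" for x using that by (auto simp: G_def max_def min_def)
  have mG: "mono G"
    unfolding G_def by (intro monoI mono_onD[OF mono]) (use \<open>a < b\<close> in auto)
  have cG: "continuous_on UNIV G"
    unfolding G_def
    by (rule continuous_on_compose2[OF abs_continuous_on_imp_continuous_on[OF ac]])
      (use \<open>a < b\<close> in \<open>auto intro!: continuous_intros\<close>)
  have acG: "abs_continuous_on {a..b} G"
    unfolding abs_continuous_on_def
  proof (intro allI impI)
    fix e :: real assume "e > 0"
    obtain \<delta> where \<delta>: "\<delta> > 0"
      and *: "\<And>d. d division_of \<Union>d \<Longrightarrow> \<Union>d \<subseteq> {a..b} \<Longrightarrow> (\<Sum>k\<in>d. Sup k - Inf k) < \<delta> \<Longrightarrow>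
        (\<Sum>k\<in>d. \<bar>F (Sup k) - F (Inf k)\<bar>) < e"
      using abs_continuous_onD[OF ac \<open>e > 0\<close>] by blast
    have "(\<Sum>k\<in>d. \<bar>G (Sup k) - G (Inf k)\<bar>) < e"
      if d: "d division_of \<Union>d" "\<Union>d \<subseteq> {a..b}" "(\<Sum>k\<in>d. Sup k - Inf k) < \<delta>" for d
    proof -
      have "Sup k \<in> {a..b}" "Inf k \<in> {a..b}" if "k \<in> d" for k
      proof -
        have "Sup k \<in> k" "Inf k \<in> k"
          using division_of_Union_real_elem[OF d(1) that] by (metis atLeastAtMost_iff order_refl)+
        then show "Sup k \<in> {a..b}" "Inf k \<in> {a..b}" using d(2) that by auto
      qed
      then have "(\<Sum>k\<in>d. \<bar>G (Sup k) - G (Inf k)\<bar>) = (\<Sum>k\<in>d. \<bar>F (Sup k) - F (Inf k)\<bar>)"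
        by (intro sum.cong) (simp_all add: G)
      then show ?thesis using *[OF d] by simp
    qed
    then show "\<exists>\<delta>>0. \<forall>d. d division_of \<Union>d \<and> \<Union>d \<subseteq> {a..b} \<and> (\<Sum>k\<in>d. Sup k - Inf k) < \<delta> \<longrightarrow>
        (\<Sum>k\<in>d. \<bar>G (Sup k) - G (Inf k)\<bar>) < e"
      using \<delta> by blast
  qed
  let ?M = "interval_measure G"
  have em: "emeasure ?M {u..v} = ennreal (G v - G u)" if "u \<le> v" for u v
    by (rule emeasure_interval_measure_Icc[OF that _ cG]) (use mG in \<open>auto dest: monoD\<close>)
  have "absolutely_continuous lborel ?M"
    unfolding absolutely_continuous_def
  proof
    fix N :: "real set" assume N: "N \<in> null_sets lborel"
    then have Nb: "N \<in> sets borel" by auto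
    have "N \<inter> {a..b} \<in> null_sets lborel" using N Nb by (intro null_set_Int2) auto
    then have 1: "N \<inter> {a..b} \<in> null_sets ?M"
      using interval_measure_null_if_abs_continuous[OF \<open>a < b\<close> mG cG acG] Nb by (auto simp: null_sets_def)
    \<comment> \<open>Outside \<open>[a, b]\<close> the function \<open>G\<close> is constant, so
      its measure charges only \<open>[a, b]\<close>.\<close>
    have 2: "{a - real n..a} \<in> null_sets ?M" "{b..b + real n} \<in> null_sets ?M" for n
      using em[of "a - real n" a] em[of b "b + real n"] \<open>a < b\<close>
      by (auto simp: null_sets_def G_def max_def min_def)
    have "(\<Union>n. {a - real n..a}) \<union> (\<Union>n. {b..b + real n}) \<in> null_sets ?M"
      using 2 by (intro null_sets.Un null_sets_UN') auto
    then have "N \<inter> {a..b} \<union> ((\<Union>n. {a - real n..a}) \<union> (\<Union>n. {b..b + real n})) \<in> null_sets ?M"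
      using 1 by (rule null_sets.Un[rotated])
    moreover have "N \<subseteq> N \<inter> {a..b} \<union> ((\<Union>n. {a - real n..a}) \<union> (\<Union>n. {b..b + real n}))"
    proof
      fix x assume "x \<in> N"
      obtain n where n: "a - x \<le> real n" using real_arch_simple by blast
      obtain m where m: "x - b \<le> real m" using real_arch_simple by blast
      have "x \<in> {a..b} \<or> x \<in> {a - real n..a} \<or> x \<in> {b..b + real m}" using n m by auto
      then show "x \<in> N \<inter> {a..b} \<union> ((\<Union>n. {a - real n..a}) \<union> (\<Union>n. {b..b + real n}))"
        using \<open>x \<in> N\<close> by blast
    qed
    ultimately show "N \<in> null_sets ?M"
      using Nb null_sets_subset by (metis sets_interval_measure)
  qed
  then obtain f where f[measurable]: "f \<in> borel_measurable lborel" and M: "density lborel f = ?M"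
    using sigma_finite_measure.Radon_Nikodym[OF sigma_finite_lborel, of ?M] by auto
  have nn: "(\<integral>\<^sup>+t. f t * indicator {a..x} t \<partial>lborel) = ennreal (F x - F a)" if "x \<in> {a..b}" for x
  proof -
    have "(\<integral>\<^sup>+t. f t * indicator {a..x} t \<partial>lborel) = emeasure (density lborel f) {a..x}"
      by (rule emeasure_density[symmetric]) auto
    then show ?thesis unfolding M using em[of a x] that G[of a] G[of x] \<open>a < b\<close> by auto
  qed
  \<comment> \<open>The Radon-Nikodym density may be infinite. Its integral over
    \<open>[a, b]\<close> is finite, so this happens there only on a null set and the real-valued
    truncation loses nothing.\<close>
  define g where "g = (\<lambda>t. enn2real (f t * indicator {a..b} t))"
  have [measurable]: "g \<in> borel_measurable borel" unfolding g_def by measurable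
  have fin: "AE t in lborel. f t * indicator {a..b} t \<noteq> \<infinity>"
    by (rule nn_integral_PInf_AE) (use nn[of b] \<open>a < b\<close> in auto)
  have hb: "has_bochner_integral lborel (\<lambda>t. indicator {a..x} t * g t) (F x - F a)" if x: "x \<in> {a..b}" for x
  proof (rule has_bochner_integral_nn_integral)
    show "0 \<le> F x - F a" using mono_onD[OF mono, of a x] x \<open>a < b\<close> by auto
    show "(\<integral>\<^sup>+t. ennreal (indicator {a..x} t * g t) \<partial>lborel) = ennreal (F x - F a)"
      unfolding nn[OF x, symmetric]
      by (rule nn_integral_cong_AE)
        (use fin in eventually_elim, use x in \<open>auto simp: g_def indicator_def ennreal_enn2real_if\<close>)
  qed (auto simp: g_def)
  show ?thesis
  proof
    have "(\<lambda>t. indicator {a..b} t * g t) = g" by (auto simp: g_def indicator_def fun_eq_iff)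
    then show "integrable lborel g" using hb[of b] \<open>a < b\<close> by (auto simp: has_bochner_integral_iff)
    show "(LBINT t:{a..x}. g t) = F x - F a" if "x \<in> {a..b}" for x
      using hb[OF that] by (simp add: has_bochner_integral_iff set_lebesgue_integral_def)
  qed
qed

lemma abs_continuous_on_density:
  assumes "a < b" and ac: "abs_continuous_on {a..b} f"
  obtains g where "integrable lborel g" "\<And>x. x \<in> {a..b} \<Longrightarrow> f x = f a + (LBINT t:{a..x}. g t)"
proof -
  obtain F G where FG: "abs_continuous_on {a..b} F" "abs_continuous_on {a..b} G"
    "mono_on {a..b} F" "mono_on {a..b} G" "\<And>x. f x = F x - G x"
    using abs_continuous_on_decompose_mono[OF ac] by blast
  obtain p where p: "integrable lborel p" "\<And>x. x \<in> {a..b} \<Longrightarrow> (LBINT t:{a..x}. p t) = F x - F a"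
    using mono_abs_continuous_density[OF \<open>a < b\<close> FG(3,1)] by blast
  obtain q where q: "integrable lborel q" "\<And>x. x \<in> {a..b} \<Longrightarrow> (LBINT t:{a..x}. q t) = G x - G a"
    using mono_abs_continuous_density[OF \<open>a < b\<close> FG(4,2)] by blast
  show ?thesis
  proof
    show "integrable lborel (\<lambda>t. p t - q t)" using p q by simp
    fix x assume x: "x \<in> {a..b}"
    have "set_integrable lborel {a..x} p" "set_integrable lborel {a..x} q"
      using p q by (auto intro: set_integrable_if_integrable)
    then show "f x = f a + (LBINT t:{a..x}. p t - q t)"
      using p(2)[OF x] q(2)[OF x] by (simp add: set_integral_diff FG(5))
  qed
qed

section \<open>Identification of the density with the derivative\<close>

text \<open>This is the Lebesgue differentiation theorem for averages over cubes with corner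
  \<open>x\<close>, read in dimension one.\<close>

lemma AE_right_derivative_integral:
  fixes g :: "real \<Rightarrow> real"
  assumes "integrable lborel g"
  shows "AE x in lebesgue. \<forall>e>0. \<exists>d>0. \<forall>h. 0 < h \<and> h < d \<longrightarrow>
           \<bar>(LBINT t:{x..x+h}. g t) / h - g x\<bar> < e"
proof -
  have si: "set_integrable lborel S g" if "S \<in> sets borel" for S
    using set_integrable_if_integrable[OF assms] that by simp
  then have "g integrable_on cbox a b" for a b
    by (intro set_borel_integral_eq_integral(1)) auto
  then obtain N where N: "negligible N"
    "\<And>x e. \<lbrakk>x \<notin> N; 0 < e\<rbrakk> \<Longrightarrow> \<exists>d>0. \<forall>h. 0 < h \<and> h < d \<longrightarrow>
       norm(integral (cbox x (x + h *\<^sub>R One)) g /\<^sub>R h ^ DIM(real) - g x) < e"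
    using integrable_ccontinuous_explicit[of g] by blast
  have "AE x in lebesgue. x \<notin> N" using N(1) by (intro AE_not_in) (simp add: negligible_iff_null_sets)
  then show ?thesis
  proof eventually_elim
    case (elim x)
    show ?case
      using N(2)[OF elim] set_borel_integral_eq_integral(2)[OF si, of "{_.._}"]
      by (simp add: divide_inverse mult.commute)
  qed
qed

text \<open>Reflection \<open>t \<mapsto> -t\<close> reduces left averages of \<open>g\<close> to
  right averages of the reflected function.\<close>

lemma AE_left_derivative_integral:
  fixes g :: "real \<Rightarrow> real"
  assumes "integrable lborel g"
  shows "AE x in lebesgue. \<forall>e>0. \<exists>d>0. \<forall>h. 0 < h \<and> h < d \<longrightarrow>
           \<bar>(LBINT t:{x-h..x}. g t) / h - g x\<bar> < e"
proof -
  let ?P = "\<lambda>x. \<forall>e>0. \<exists>d>0. \<forall>h. 0 < h \<and> h < d \<longrightarrow>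
           \<bar>(LBINT t:{x..x+h}. g (- t)) / h - g (- x)\<bar> < e"
  have "integrable lborel (\<lambda>t. g (- t))"
    using lborel_integrable_real_affine[OF assms, of "-1" 0] by simp
  from AE_right_derivative_integral[OF this] have "AE x in lebesgue. ?P x" .
  then obtain N where N: "N \<in> null_sets lebesgue" "{x. \<not> ?P x} \<subseteq> N"
    by (auto simp: eventually_ae_filter)
  \<comment> \<open>The exceptional set has to be reflected too; differentiable images of null sets
    are null.\<close>
  have "negligible (uminus ` N)"
    using N(1) by (intro negligible_differentiable_image_negligible)
      (auto simp: negligible_iff_null_sets intro!: derivative_intros)
  then have "AE x in lebesgue. x \<notin> uminus ` N"
    by (intro AE_not_in) (simp add: negligible_iff_null_sets)
  then show ?thesis
  proof eventually_elim
    case (elim x)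
    then have "- x \<notin> N" by (metis imageI minus_minus)
    then have "?P (- x)" using N(2) by blast
    moreover have "(LBINT t:{-x..-x+h}. g (- t)) = (LBINT t:{x-h..x}. g t)" for h
    proof -
      have "(LBINT t:{x-h..x}. g t) = (LBINT t. indicator {x-h..x} (- t) *\<^sub>R g (- t))"
        using lborel_integral_real_affine[of "-1" "\<lambda>t. indicator {x-h..x} t *\<^sub>R g t" 0]
        by (simp add: set_lebesgue_integral_def)
      also have "\<dots> = (LBINT t:{-x..-x+h}. g (- t))"
        unfolding set_lebesgue_integral_def
        by (rule Bochner_Integration.integral_cong) (auto simp: indicator_def)
      finally show ?thesis by simp
    qed
    ultimately show ?case by simp
  qed
qed

text \<open>One-sided difference quotients of \<open>f\<close> are one-sided averages of
  \<open>g\<close>. Where both averages converge to \<open>g x\<close>, the two-sided derivative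
  exists and equals \<open>g x\<close>.\<close>

lemma abs_continuous_on_AE_deriv:
  assumes "a < b" and ac: "abs_continuous_on {a..b} f"
  obtains g where "integrable lborel g" "\<And>x. x \<in> {a..b} \<Longrightarrow> f x = f a + (LBINT t:{a..x}. g t)"
    "AE x in lebesgue. x \<in> {a..b} \<longrightarrow> deriv f x = g x"
proof -
  obtain g where g: "integrable lborel g" "\<And>x. x \<in> {a..b} \<Longrightarrow> f x = f a + (LBINT t:{a..x}. g t)"
    using abs_continuous_on_density[OF assms] by blast
  have si: "set_integrable lborel S g" if "S \<in> sets borel" for S
    using set_integrable_if_integrable[OF g(1)] that by simp
  have diff: "f v - f u = (LBINT t:{u..v}. g t)" if "a \<le> u" "u \<le> v" "v \<le> b" for u v
  proof -
    have "integral {a..u} g + integral {u..v} g = integral {a..v} g"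
      by (rule Henstock_Kurzweil_Integration.integral_combine)
        (use that si in \<open>auto intro: set_borel_integral_eq_integral(1)\<close>)
    then show ?thesis
      using g(2)[of u] g(2)[of v] that si by (simp add: set_borel_integral_eq_integral(2))
  qed
  \<comment> \<open>\<open>deriv\<close> is two-sided and \<open>f\<close> is arbitrary outside
    \<open>[a, b]\<close>, so the end points are discarded.\<close>
  have "AE x in lebesgue. x \<noteq> a \<and> x \<noteq> b"
    using AE_not_in[of "{a,b}" lebesgue] by (simp add: negligible_iff_null_sets[symmetric])
  then have "AE x in lebesgue. x \<in> {a..b} \<longrightarrow> deriv f x = g x"
    using AE_right_derivative_integral[OF g(1)] AE_left_derivative_integral[OF g(1)]
  proof eventually_elim
    case (elim x)
    show ?case
    proof
      assume "x \<in> {a..b}"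
      with elim have x: "a < x" "x < b" by auto
      have "(\<lambda>h. (f (x + h) - f x) / h) \<midarrow>0\<rightarrow> g x"
      proof (rule LIM_I)
        fix e :: real assume "e > 0"
        obtain d1 where d1: "d1 > 0" "\<And>h. 0 < h \<and> h < d1 \<Longrightarrow> \<bar>(LBINT t:{x..x+h}. g t) / h - g x\<bar> < e"
          using elim(2) \<open>e > 0\<close> by blast
        obtain d2 where d2: "d2 > 0" "\<And>h. 0 < h \<and> h < d2 \<Longrightarrow> \<bar>(LBINT t:{x-h..x}. g t) / h - g x\<bar> < e"
          using elim(3) \<open>e > 0\<close> by blast
        \<comment> \<open>The last two bounds keep \<open>x + h\<close> in \<open>[a, b]\<close>,
          where \<open>f\<close> is given by the integral of \<open>g\<close>.\<close>
        define s where "s = min (min d1 d2) (min (x - a) (b - x))"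
        have "s > 0" using d1 d2 x by (auto simp: s_def)
        moreover have "\<bar>(f (x + h) - f x) / h - g x\<bar> < e" if "h \<noteq> 0" "\<bar>h\<bar> < s" for h
        proof (cases "h > 0")
          case True
          then show ?thesis using d1(2)[of h] diff[of x "x + h"] that x by (auto simp: s_def)
        next
          case False
          then have "f x - f (x + h) = (LBINT t:{x-(-h)..x}. g t)"
            using diff[of "x + h" x] that x by (auto simp: s_def)
          moreover have "(f (x + h) - f x) / h = (f x - f (x + h)) / (- h)"
            by (simp add: minus_divide_left)
          ultimately show ?thesis using d2(2)[of "-h"] False that by (auto simp: s_def)
        qed
        ultimately show "\<exists>s>0. \<forall>h. h \<noteq> 0 \<and> norm (h - 0) < s \<longrightarrow> norm ((f (x + h) - f x) / h - g x) < e"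
          by auto
      qed
      then have "(f has_field_derivative g x) (at x)" by (simp add: DERIV_def)
      then show "deriv f x = g x" by (rule DERIV_imp_deriv)
    qed
  qed
  with g show ?thesis using that by blast
qed

text \<open>The operators integrate over \<open>lebesgue\<close>, while product measurability and
  Fubini are used for Borel functions over \<open>lborel\<close>. Completeness makes
  \<open>\<phi>\<close> measurable once it agrees almost everywhere with a Borel function.\<close>

lemma lebesgue_lborel_transfer:
  fixes \<phi> \<psi> :: "real \<Rightarrow> real"
  assumes [measurable]: "\<psi> \<in> borel_measurable borel" and ae: "AE x in lebesgue. \<phi> x = \<psi> x"
  shows "integrable lebesgue \<phi> \<longleftrightarrow> integrable lborel \<psi>"
    "integral\<^sup>L lebesgue \<phi> = integral\<^sup>L lborel \<psi>"
proof -
  have \<psi>: "\<psi> \<in> borel_measurable lebesgue" by (rule measurable_completion) simp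
  have \<phi>: "\<phi> \<in> borel_measurable lebesgue"
    by (rule borel_measurable_AE[OF \<psi>]) (use ae in eventually_elim, simp)
  show "integrable lebesgue \<phi> \<longleftrightarrow> integrable lborel \<psi>"
    using integrable_cong_AE[OF \<phi> \<psi> ae] integrable_completion[of \<psi> lborel] by simp
  show "integral\<^sup>L lebesgue \<phi> = integral\<^sup>L lborel \<psi>"
    using integral_cong_AE[OF \<phi> \<psi> ae] integral_completion[of \<psi> lborel] by simp
qed

lemma abs_continuous_on_deriv_integral:
  assumes "a < b" and ac: "abs_continuous_on {a..b} f"
  shows "set_integrable lebesgue {a..b} (deriv f)"
    and "\<And>x. x \<in> {a..b} \<Longrightarrow> (LINT t:{a..x}|lebesgue. deriv f t) = f x - f a"
proof -
  obtain g where g: "integrable lborel g" "\<And>x. x \<in> {a..b} \<Longrightarrow> f x = f a + (LBINT t:{a..x}. g t)"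
    and ae: "AE x in lebesgue. x \<in> {a..b} \<longrightarrow> deriv f x = g x"
    using abs_continuous_on_AE_deriv[OF assms] by blast
  have gm[measurable]: "g \<in> borel_measurable borel" using borel_measurable_integrable[OF g(1)] by simp
  have e: "AE t in lebesgue. indicator {a..x} t *\<^sub>R deriv f t = indicator {a..x} t *\<^sub>R g t"
    if "x \<in> {a..b}" for x
    using ae by eventually_elim (use that in \<open>auto simp: indicator_def\<close>)
  have m: "(\<lambda>t. indicator {a..x} t *\<^sub>R g t) \<in> borel_measurable borel" for x by measurable
  show "set_integrable lebesgue {a..b} (deriv f)"
    using lebesgue_lborel_transfer(1)[OF m e[of b]] set_integrable_if_integrable[OF g(1), of "{a..b}"] \<open>a < b\<close>
    by (simp add: set_integrable_def)
  show "(LINT t:{a..x}|lebesgue. deriv f t) = f x - f a" if "x \<in> {a..b}" for x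
    using lebesgue_lborel_transfer(2)[OF m e[OF that]] g(2)[OF that]
    by (simp add: set_lebesgue_integral_def)
qed

section \<open>Fubini for convolution kernels\<close>

lemma set_borel_measurable_lebesgue_borel_rep:
  fixes f :: "real \<Rightarrow> real"
  assumes "set_borel_measurable lebesgue S f"
  obtains g where "g \<in> borel_measurable borel" "AE x in lebesgue. indicator S x * f x = g x"
proof -
  have "(\<lambda>x. indicator S x * f x) \<in> borel_measurable lebesgue"
    using assms by (simp add: set_borel_measurable_def)
  from completion_ex_borel_measurable_real[OF this] show ?thesis
    using that by (auto intro: AE_completion)
qed

text \<open>Both iterated integrals come from \<open>k (x - t) * h t * g x\<close> on the triangle
  \<open>a \<le> t \<le> x \<le> b\<close>. The uniform bound \<open>B\<close> on the slices
  dominates the inner integral of the absolute value by a multiple of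
  \<open>\<bar>h t\<bar>\<close>, which yields integrability on the product.\<close>

lemma convolution_kernel_Fubini:
  fixes k h g :: "real \<Rightarrow> real"
  assumes k[measurable]: "k \<in> borel_measurable borel"
    and h: "set_integrable lebesgue {a..b} h"
    and g: "set_borel_measurable lebesgue {a..b} g"
    and slice: "\<And>t. t \<in> {a..b} \<Longrightarrow> set_integrable lebesgue {t..b} (\<lambda>x. k (x - t) * g x)"
    and bnd: "\<And>t. t \<in> {a..b} \<Longrightarrow> (LINT x:{t..b}|lebesgue. \<bar>k (x - t) * g x\<bar>) \<le> B"
  shows "set_integrable lebesgue {a..b} (\<lambda>t. h t * (LINT x:{t..b}|lebesgue. k (x - t) * g x))"
    and "set_integrable lebesgue {a..b} (\<lambda>x. g x * (LINT t:{a..x}|lebesgue. k (x - t) * h t))"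
    and "(LINT x:{a..b}|lebesgue. g x * (LINT t:{a..x}|lebesgue. k (x - t) * h t)) =
         (LINT t:{a..b}|lebesgue. h t * (LINT x:{t..b}|lebesgue. k (x - t) * g x))"
proof -
  have "set_borel_measurable lebesgue {a..b} h"
    using h unfolding set_borel_measurable_def set_integrable_def by (rule borel_measurable_integrable)
  then obtain h0 where h0[measurable]: "h0 \<in> borel_measurable borel"
    and h0e: "AE x in lebesgue. indicator {a..b} x * h x = h0 x"
    by (rule set_borel_measurable_lebesgue_borel_rep)
  obtain g0 where g0[measurable]: "g0 \<in> borel_measurable borel"
    and g0e: "AE x in lebesgue. indicator {a..b} x * g x = g0 x"
    using g by (rule set_borel_measurable_lebesgue_borel_rep)
  \<comment> \<open>The Borel representatives \<open>h0\<close> and \<open>g0\<close> make the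
    integrand on the triangle product measurable.\<close>
  define K where "K = (\<lambda>t x. if a \<le> t \<and> t \<le> x \<and> x \<le> b then k (x - t) * h0 t * g0 x else 0)"
  have Km[measurable]: "(\<lambda>(t, x). K t x) \<in> borel_measurable (borel \<Otimes>\<^sub>M borel)"
    unfolding K_def by measurable
  have K1[measurable]: "K t \<in> borel_measurable borel" for t
    unfolding K_def by measurable
  have K2[measurable]: "(\<lambda>t. K t x) \<in> borel_measurable borel" for x
    unfolding K_def by measurable
  have h0i: "integrable lborel h0"
    using lebesgue_lborel_transfer(1)[OF h0 h0e] h by (simp add: set_integrable_def)
  define H where "H = (\<lambda>t. LINT x:{t..b}|lebesgue. k (x - t) * g x)"
  define G where "G = (\<lambda>x. LINT t:{a..x}|lebesgue. k (x - t) * h t)"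
  have Kt: "AE x in lebesgue. h0 t * (indicator {t..b} x *\<^sub>R (k (x - t) * g x)) = K t x"
    "AE x in lebesgue. \<bar>h0 t\<bar> * (indicator {t..b} x *\<^sub>R \<bar>k (x - t) * g x\<bar>) = \<bar>K t x\<bar>"
    if "t \<in> {a..b}" for t
    by (use g0e in eventually_elim, use that in \<open>auto simp: K_def indicator_def abs_mult\<close>)+
  have Kint: "integrable lborel (K t)" "(\<integral>x. K t x \<partial>lborel) = h0 t * H t"
    "(\<integral>x. \<bar>K t x\<bar> \<partial>lborel) \<le> \<bar>h0 t\<bar> * B" if t: "t \<in> {a..b}" for t
  proof -
    note 1 = lebesgue_lborel_transfer[OF K1 Kt(1)[OF t]]
    show "integrable lborel (K t)"
      using 1(1) slice[OF t] by (simp add: set_integrable_def)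
    show "(\<integral>x. K t x \<partial>lborel) = h0 t * H t"
      using 1(2) by (simp add: H_def set_lebesgue_integral_def)
    have "(\<integral>x. \<bar>K t x\<bar> \<partial>lborel) = \<bar>h0 t\<bar> * (LINT x:{t..b}|lebesgue. \<bar>k (x - t) * g x\<bar>)"
      using lebesgue_lborel_transfer(2)[OF _ Kt(2)[OF t]] by (simp add: set_lebesgue_integral_def)
    also have "\<dots> \<le> \<bar>h0 t\<bar> * B" by (rule mult_left_mono[OF bnd[OF t]]) simp
    finally show "(\<integral>x. \<bar>K t x\<bar> \<partial>lborel) \<le> \<bar>h0 t\<bar> * B" .
  qed
  have K0: "K t = (\<lambda>x. 0)" if "t \<notin> {a..b}" for t
    using that by (auto simp: K_def fun_eq_iff)
  have Kint': "integrable lborel (K t)" for t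
    by (cases "t \<in> {a..b}") (use Kint(1) K0 in auto)
  have Ki: "integrable (lborel \<Otimes>\<^sub>M lborel) (case_prod K)"
  proof (rule lborel_pair.Fubini_integrable)
    show "integrable lborel (\<lambda>t. \<integral>x. norm (case (t, x) of (t, x) \<Rightarrow> K t x) \<partial>lborel)"
    proof (rule Bochner_Integration.integrable_bound)
      show "integrable lborel (\<lambda>t. \<bar>h0 t\<bar> * B)" using h0i by simp
      show "AE t in lborel. norm (\<integral>x. norm (case (t, x) of (t, x) \<Rightarrow> K t x) \<partial>lborel) \<le> norm (\<bar>h0 t\<bar> * B)"
      proof (rule AE_I2)
        fix t
        \<comment> \<open>Nothing forces \<open>B\<close> to be nonnegative when
          \<open>{a..b}\<close> is empty, hence its absolute value.\<close>
        have "\<bar>\<integral>x. \<bar>K t x\<bar> \<partial>lborel\<bar> \<le> \<bar>h0 t\<bar> * \<bar>B\<bar>"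
        proof (cases "t \<in> {a..b}")
          case True
          have "\<bar>\<integral>x. \<bar>K t x\<bar> \<partial>lborel\<bar> = (\<integral>x. \<bar>K t x\<bar> \<partial>lborel)" by simp
          also have "\<dots> \<le> \<bar>h0 t\<bar> * B" by (rule Kint(3)[OF True])
          also have "\<dots> \<le> \<bar>h0 t\<bar> * \<bar>B\<bar>" by (rule mult_left_mono) auto
          finally show ?thesis .
        qed (simp add: K0)
        then show "norm (\<integral>x. norm (case (t, x) of (t, x) \<Rightarrow> K t x) \<partial>lborel) \<le> norm (\<bar>h0 t\<bar> * B)"
          by (simp add: abs_mult)
      qed
    qed measurable
  qed (use Km Kint' in \<open>auto simp: space_pair_measure\<close>)
  have G: "(\<integral>t. K t x \<partial>lborel) = g0 x * G x" if x: "x \<in> {a..b}" for x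
  proof -
    have "AE t in lebesgue. g0 x * (indicator {a..x} t *\<^sub>R (k (x - t) * h t)) = K t x"
      by (use h0e in eventually_elim, use x in \<open>auto simp: K_def indicator_def\<close>)
    from lebesgue_lborel_transfer(2)[OF K2 this] show ?thesis
      by (simp add: G_def set_lebesgue_integral_def)
  qed
  have G0: "(\<integral>t. K t x \<partial>lborel) = 0" if "x \<notin> {a..b}" for x
  proof -
    have "(\<lambda>t. K t x) = (\<lambda>t. 0)" using that by (auto simp: K_def fun_eq_iff)
    then show ?thesis by simp
  qed
  have e1: "AE t in lebesgue. indicator {a..b} t *\<^sub>R (h t * H t) = (\<integral>x. K t x \<partial>lborel)"
    using h0e by eventually_elim (auto simp: indicator_def Kint(2) K0)
  have e2: "AE x in lebesgue. indicator {a..b} x *\<^sub>R (g x * G x) = (\<integral>t. K t x \<partial>lborel)"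
    using g0e by eventually_elim (auto simp: indicator_def G G0)
  have m1: "(\<lambda>t. \<integral>x. K t x \<partial>lborel) \<in> borel_measurable borel" by measurable
  have m2: "(\<lambda>x. \<integral>t. K t x \<partial>lborel) \<in> borel_measurable borel" by measurable
  show "set_integrable lebesgue {a..b} (\<lambda>t. h t * (LINT x:{t..b}|lebesgue. k (x - t) * g x))"
    using lebesgue_lborel_transfer(1)[OF m1 e1] lborel_pair.integrable_fst[OF Ki]
    by (simp add: set_integrable_def H_def)
  show "set_integrable lebesgue {a..b} (\<lambda>x. g x * (LINT t:{a..x}|lebesgue. k (x - t) * h t))"
    using lebesgue_lborel_transfer(1)[OF m2 e2] lborel_pair.integrable_snd[OF Ki]
    by (simp add: set_integrable_def G_def)
  show "(LINT x:{a..b}|lebesgue. g x * (LINT t:{a..x}|lebesgue. k (x - t) * h t)) =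
         (LINT t:{a..b}|lebesgue. h t * (LINT x:{t..b}|lebesgue. k (x - t) * g x))"
    using lebesgue_lborel_transfer(2)[OF m1 e1] lebesgue_lborel_transfer(2)[OF m2 e2]
      lborel_pair.Fubini_integral[OF Ki]
    by (simp add: set_lebesgue_integral_def G_def H_def)
qed

section \<open>Power kernels and integration by parts\<close>

text \<open>For \<open>\<gamma> < 1\<close> the kernel is singular at \<open>t\<close>, but its
  antiderivative is continuous up to \<open>t\<close>, so the fundamental theorem with derivatives
  in the interior applies. Nonnegativity upgrades integrability to absolute integrability.\<close>

lemma powr_kernel_integral:
  fixes \<gamma> t b :: real
  assumes "\<gamma> > 0" "t \<le> b"
  shows "set_integrable lebesgue {t..b} (\<lambda>x. (x - t) powr (\<gamma> - 1))"
    and "(LINT x:{t..b}|lebesgue. (x - t) powr (\<gamma> - 1)) = (b - t) powr \<gamma> / \<gamma>"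
proof -
  have hi: "((\<lambda>x. (x - t) powr (\<gamma> - 1)) has_integral (b - t) powr \<gamma> / \<gamma> - (t - t) powr \<gamma> / \<gamma>) {t..b}"
  proof (rule fundamental_theorem_of_calculus_interior)
    show "continuous_on {t..b} (\<lambda>x. (x - t) powr \<gamma> / \<gamma>)"
      using \<open>\<gamma> > 0\<close> by (intro continuous_intros continuous_on_powr') auto
    fix x assume "x \<in> {t<..<b}"
    then show "((\<lambda>x. (x - t) powr \<gamma> / \<gamma>) has_vector_derivative (x - t) powr (\<gamma> - 1)) (at x)"
      using \<open>\<gamma> > 0\<close> unfolding has_real_derivative_iff_has_vector_derivative[symmetric]
      by (auto intro!: derivative_eq_intros simp: powr_diff)
  qed (rule assms)
  then show 1: "set_integrable lebesgue {t..b} (\<lambda>x. (x - t) powr (\<gamma> - 1))"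
    by (intro nonnegative_absolutely_integrable_1) auto
  show "(LINT x:{t..b}|lebesgue. (x - t) powr (\<gamma> - 1)) = (b - t) powr \<gamma> / \<gamma>"
    using hi set_lebesgue_integral_eq_integral(2)[OF 1] by (auto simp: integral_unique)
qed

text \<open>These are the slice hypotheses of \<open>convolution_kernel_Fubini\<close>: a bounded
  \<open>g\<close> against an integrable kernel whose integral is at most
  \<open>(b - a) powr \<gamma> / \<gamma>\<close> for every \<open>t\<close>.\<close>

lemma powr_kernel_slice:
  fixes \<gamma> t b :: real
  assumes "\<gamma> > 0" and g: "continuous_on {a..b} g"
  obtains B where "\<And>t. t \<in> {a..b} \<Longrightarrow> set_integrable lebesgue {t..b} (\<lambda>x. (x - t) powr (\<gamma> - 1) * g x)"
    "\<And>t. t \<in> {a..b} \<Longrightarrow> (LINT x:{t..b}|lebesgue. \<bar>(x - t) powr (\<gamma> - 1) * g x\<bar>) \<le> B"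
proof -
  have "bounded (g ` {a..b})" using compact_continuous_image[OF g] compact_imp_bounded by blast
  then obtain C where "\<forall>x\<in>{a..b}. \<bar>g x\<bar> \<le> C" by (auto simp: bounded_iff)
  then have C: "\<And>x. x \<in> {a..b} \<Longrightarrow> \<bar>g x\<bar> \<le> C" by blast
  have si: "set_integrable lebesgue {t..b} (\<lambda>x. (x - t) powr (\<gamma> - 1) * g x)" if t: "t \<in> {a..b}" for t
  proof -
    have "set_integrable lebesgue {t..b} (\<lambda>x. g x * (x - t) powr (\<gamma> - 1))"
    proof (rule absolutely_integrable_bounded_measurable_product_real)
      have ct: "continuous_on {t..b} g" by (rule continuous_on_subset[OF g]) (use t in auto)
      then show "g \<in> borel_measurable (lebesgue_on {t..b})"
        by (intro continuous_imp_measurable_on_sets_lebesgue) auto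
      show "bounded (g ` {t..b})" using compact_continuous_image[OF ct] compact_imp_bounded by blast
    qed (use powr_kernel_integral(1)[OF \<open>\<gamma> > 0\<close>, of t b] t in auto)
    then show ?thesis by (simp add: mult.commute)
  qed
  moreover have "(LINT x:{t..b}|lebesgue. \<bar>(x - t) powr (\<gamma> - 1) * g x\<bar>) \<le> (b - a) powr \<gamma> / \<gamma> * \<bar>C\<bar>"
    if t: "t \<in> {a..b}" for t
  proof -
    have le: "t \<le> b" using t by simp
    have "(LINT x:{t..b}|lebesgue. \<bar>(x - t) powr (\<gamma> - 1) * g x\<bar>)
      \<le> (LINT x:{t..b}|lebesgue. (x - t) powr (\<gamma> - 1) * \<bar>C\<bar>)"
    proof (rule set_integral_mono)
      show "set_integrable lebesgue {t..b} (\<lambda>x. \<bar>(x - t) powr (\<gamma> - 1) * g x\<bar>)"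
        by (rule set_integrable_abs[OF si[OF t]])
      show "set_integrable lebesgue {t..b} (\<lambda>x. (x - t) powr (\<gamma> - 1) * \<bar>C\<bar>)"
        using powr_kernel_integral(1)[OF \<open>\<gamma> > 0\<close> le] by simp
      fix x assume "x \<in> {t..b}"
      then have "\<bar>g x\<bar> \<le> \<bar>C\<bar>" using C[of x] t by auto
      then show "\<bar>(x - t) powr (\<gamma> - 1) * g x\<bar> \<le> (x - t) powr (\<gamma> - 1) * \<bar>C\<bar>"
        by (simp add: abs_mult mult_left_mono)
    qed
    also have "\<dots> = (b - t) powr \<gamma> / \<gamma> * \<bar>C\<bar>"
      using powr_kernel_integral(2)[OF \<open>\<gamma> > 0\<close> le] by simp
    also have "\<dots> \<le> (b - a) powr \<gamma> / \<gamma> * \<bar>C\<bar>"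
      using t \<open>\<gamma> > 0\<close> by (intro mult_right_mono divide_right_mono powr_mono2) auto
    finally show ?thesis .
  qed
  ultimately show ?thesis using that by blast
qed

lemma continuous_on_set_borel_measurable_lebesgue:
  fixes g :: "real \<Rightarrow> real"
  assumes "continuous_on {a..b} g"
  shows "set_borel_measurable lebesgue {a..b} g"
  using absolutely_integrable_continuous_real[OF assms]
  unfolding set_borel_measurable_def set_integrable_def by (rule borel_measurable_integrable)

text \<open>Up to the factor \<open>1 / Gamma \<gamma>\<close> this says that the left and right
  fractional integrals are adjoint.\<close>

lemma powr_kernel_Fubini:
  fixes \<gamma> :: real
  assumes "\<gamma> > 0" and g: "continuous_on {a..b} g" and h: "set_integrable lebesgue {a..b} h"
  shows "set_integrable lebesgue {a..b} (\<lambda>t. h t * (LINT x:{t..b}|lebesgue. (x - t) powr (\<gamma> - 1) * g x))"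
    and "(LINT x:{a..b}|lebesgue. g x * (LINT t:{a..x}|lebesgue. (x - t) powr (\<gamma> - 1) * h t)) =
         (LINT t:{a..b}|lebesgue. h t * (LINT x:{t..b}|lebesgue. (x - t) powr (\<gamma> - 1) * g x))"
proof -
  obtain B where B: "\<And>t. t \<in> {a..b} \<Longrightarrow> set_integrable lebesgue {t..b} (\<lambda>x. (x - t) powr (\<gamma> - 1) * g x)"
    "\<And>t. t \<in> {a..b} \<Longrightarrow> (LINT x:{t..b}|lebesgue. \<bar>(x - t) powr (\<gamma> - 1) * g x\<bar>) \<le> B"
    using powr_kernel_slice[OF assms(1,2)] by blast
  note * = convolution_kernel_Fubini[where k="\<lambda>s. s powr (\<gamma> - 1)", OF _ h
      continuous_on_set_borel_measurable_lebesgue[OF g] B]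
  show "set_integrable lebesgue {a..b} (\<lambda>t. h t * (LINT x:{t..b}|lebesgue. (x - t) powr (\<gamma> - 1) * g x))"
    by (rule *(1)) auto
  show "(LINT x:{a..b}|lebesgue. g x * (LINT t:{a..x}|lebesgue. (x - t) powr (\<gamma> - 1) * h t)) =
         (LINT t:{a..b}|lebesgue. h t * (LINT x:{t..b}|lebesgue. (x - t) powr (\<gamma> - 1) * g x))"
    by (rule *(3)) auto
qed

text \<open>The case of the kernel 1. It serves twice: for ordinary integration by parts against
  \<open>deriv u\<close>, and for moving the \<open>z\<close>-term of the functional onto the
  increment of \<open>l\<close>.\<close>

lemma indefinite_integral_Fubini:
  fixes g h :: "real \<Rightarrow> real"
  assumes g: "set_integrable lebesgue {a..b} g" and h: "set_integrable lebesgue {a..b} h"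
  shows "set_integrable lebesgue {a..b} (\<lambda>t. h t * (LINT x:{t..b}|lebesgue. g x))"
    and "set_integrable lebesgue {a..b} (\<lambda>x. g x * (LINT t:{a..x}|lebesgue. h t))"
    and "(LINT x:{a..b}|lebesgue. g x * (LINT t:{a..x}|lebesgue. h t)) =
         (LINT t:{a..b}|lebesgue. h t * (LINT x:{t..b}|lebesgue. g x))"
proof -
  have gm: "set_borel_measurable lebesgue {a..b} g"
    using g unfolding set_borel_measurable_def set_integrable_def by (rule borel_measurable_integrable)
  have si: "set_integrable lebesgue {t..b} g" if "t \<in> {a..b}" for t
    by (rule set_integrable_subset[OF g]) (use that in auto)
  have bnd: "(LINT x:{t..b}|lebesgue. \<bar>g x\<bar>) \<le> (LINT x:{a..b}|lebesgue. \<bar>g x\<bar>)" if "t \<in> {a..b}" for t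
    unfolding set_lebesgue_integral_def
    by (rule Bochner_Integration.integral_mono)
      (use set_integrable_abs[OF si[OF that]] set_integrable_abs[OF g] that
        in \<open>auto simp: set_integrable_def indicator_def\<close>)
  note * = convolution_kernel_Fubini[where k="\<lambda>s. 1", simplified, OF h gm si bnd]
  show "set_integrable lebesgue {a..b} (\<lambda>t. h t * (LINT x:{t..b}|lebesgue. g x))"
    by (rule *(1)) auto
  show "set_integrable lebesgue {a..b} (\<lambda>x. g x * (LINT t:{a..x}|lebesgue. h t))"
    by (rule *(2)) auto
  show "(LINT x:{a..b}|lebesgue. g x * (LINT t:{a..x}|lebesgue. h t)) =
         (LINT t:{a..b}|lebesgue. h t * (LINT x:{t..b}|lebesgue. g x))"
    by (rule *(3)) auto
qed

section \<open>The weak Euler-Lagrange equation and convexity\<close>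

lemma admissibleD:
  assumes "u \<in> admissible a b \<alpha> \<beta>"
  shows "abs_continuous_on {a..b} u" "continuous_on {a..b} u" "continuous_on {a..b} (caputo_left a \<alpha> u)"
    "continuous_on {a..b} (rl_int_left a \<beta> u)"
  using assms abs_continuous_on_imp_continuous_on by (auto simp: admissible_def)

lemma continuous_on_set_integrable_lebesgue:
  fixes f :: "real \<Rightarrow> real"
  shows "continuous_on {a..b} f \<Longrightarrow> set_integrable lebesgue {a..b} f"
  by (rule absolutely_integrable_continuous_real)

text \<open>
  The identity is stated for one admissible \<open>u\<close> rather than for a difference of two, so that no
  linearity of \<open>deriv\<close> is needed: it may fail where one of the functions is not differentiable.
\<close>

lemma weak_euler_lagrange:
  assumes "a < b" "0 < \<alpha>" "\<alpha> < 1" "\<beta> > 0" and u: "u \<in> admissible a b \<alpha> \<beta>"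
    and A: "continuous_on {a..b} A" and p: "continuous_on {a..b} p" and q: "continuous_on {a..b} q"
    and deriv: "\<And>x. x \<in> {a..b} \<Longrightarrow>
      ((\<lambda>u. LINT t:{u..b}|lebesgue. (t - u) powr (- \<alpha>) * p t) has_vector_derivative D x) (at x within {a..b})"
    and eq: "\<And>x. x \<in> {a..b} \<Longrightarrow> A x - D x / Gamma (1 - \<alpha>) + rl_int_right b \<beta> q x = 0"
    and bc: "(LINT t:{a..b}|lebesgue. (t - a) powr (- \<alpha>) * p t) = 0"
  shows "(LINT x:{a..b}|lebesgue. A x * u x + p x * caputo_left a \<alpha> u x + q x * rl_int_left a \<beta> u x) = 0"
proof -
  note uD = admissibleD[OF u]
  define R where "R = rl_int_right b \<beta> q"
  define P where "P = (\<lambda>u. LINT t:{u..b}|lebesgue. (t - u) powr (- \<alpha>) * p t)"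
  define c where "c = Gamma (1 - \<alpha>)"
  have c: "c > 0" using \<open>\<alpha> < 1\<close> by (simp add: c_def Gamma_real_pos)
  \<comment> \<open>Solving the equation for \<open>D\<close> gives its integrability, which its
    role as a pointwise derivative does not provide.\<close>
  have D: "D x = c * (A x + R x)" if "x \<in> {a..b}" for x
    using eq[OF that] c by (simp add: R_def c_def[symmetric] field_simps)
  \<comment> \<open>Fubini with the constant function \<open>1 / Gamma \<beta>\<close> in place of
    \<open>h\<close>.\<close>
  have Ri: "set_integrable lebesgue {a..b} R"
    using powr_kernel_Fubini(1)[OF \<open>\<beta> > 0\<close> q continuous_on_set_integrable_lebesgue[OF continuous_on_const[of _ "1 / Gamma \<beta>"]]]
    by (simp add: R_def rl_int_right_def[abs_def])
  have "set_integrable lebesgue {a..b} (\<lambda>x. c * (A x + R x))"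
    by (intro set_integrable_mult_right set_integral_add Ri continuous_on_set_integrable_lebesgue A)
  then have Di: "set_integrable lebesgue {a..b} D"
    by (subst set_integrable_cong[OF refl refl D]) auto
  \<comment> \<open>On the single point \<open>b\<close> the kernel is
    \<open>0 powr (- \<alpha>)\<close>, which is 0.\<close>
  have "P b = (LINT t:{b..b}|lebesgue. 0)"
    unfolding P_def by (rule set_lebesgue_integral_cong) auto
  then have Pb: "P b = 0" by simp
  have Pa: "P a = 0" using bc by (simp add: P_def)
  have P: "P t = - (LINT x:{t..b}|lebesgue. D x)" if t: "t \<in> {a..b}" for t
  proof -
    have "(D has_integral P b - P t) {t..b}"
    proof (rule fundamental_theorem_of_calculus)
      fix x assume "x \<in> {t..b}"
      then show "(P has_vector_derivative D x) (at x within {t..b})"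
        unfolding P_def
        by (intro has_vector_derivative_within_subset[OF deriv]) (use t in auto)
    qed (use t in auto)
    moreover have "set_integrable lebesgue {t..b} D"
      by (rule set_integrable_subset[OF Di]) (use t in auto)
    ultimately show ?thesis
      using set_lebesgue_integral_eq_integral(2)[of "{t..b}" D] Pb by (simp add: integral_unique)
  qed
  \<comment> \<open>The natural boundary condition \<open>P a = 0\<close> makes \<open>D\<close>
    have integral zero. This later removes the term with \<open>u a\<close>, whose value is not
    prescribed.\<close>
  have D0: "(LINT x:{a..b}|lebesgue. D x) = 0"
    using P[of a] Pa \<open>a < b\<close> by simp
  note u' = abs_continuous_on_deriv_integral[OF \<open>a < b\<close> uD(1)]
  \<comment> \<open>Integrability of \<open>D x * u x\<close> is derived by writing
    \<open>u x - u a\<close> as the integral of \<open>deriv u\<close> and adding back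
    \<open>D x * u a\<close>.\<close>
  have "set_integrable lebesgue {a..b} (\<lambda>x. D x * (LINT t:{a..x}|lebesgue. deriv u t))"
    by (rule indefinite_integral_Fubini(2)[OF Di u'(1)])
  then have "set_integrable lebesgue {a..b} (\<lambda>x. D x * (u x - u a))"
    by (rule set_integrable_cong[THEN iffD1, rotated -1]) (auto simp: u'(2))
  then have "set_integrable lebesgue {a..b} (\<lambda>x. D x * (u x - u a) + D x * u a)"
    by (rule set_integral_add(1)) (use Di in simp)
  then have Dui: "set_integrable lebesgue {a..b} (\<lambda>x. D x * u x)"
    by (simp add: algebra_simps)
  \<comment> \<open>Integration by parts in two exchanges: the kernel of order
    \<open>1 - \<alpha>\<close> passes from \<open>deriv u\<close> to \<open>p\<close>, giving
    \<open>P\<close>; then \<open>P\<close> is written as a tail integral of \<open>D\<close>, and a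
    second exchange integrates \<open>deriv u\<close> back to \<open>u\<close>.\<close>
  have "(LINT x:{a..b}|lebesgue. p x * caputo_left a \<alpha> u x)
      = (LINT x:{a..b}|lebesgue. p x * (LINT t:{a..x}|lebesgue. (x - t) powr ((1 - \<alpha>) - 1) * deriv u t)) / c"
    by (simp add: caputo_left_def c_def)
  also have "\<dots> = (LINT t:{a..b}|lebesgue. deriv u t * P t) / c"
    using powr_kernel_Fubini(2)[OF _ p u'(1), of "1 - \<alpha>"] \<open>\<alpha> < 1\<close> by (simp add: P_def)
  also have "(LINT t:{a..b}|lebesgue. deriv u t * P t)
      = (LINT t:{a..b}|lebesgue. - (deriv u t * (LINT x:{t..b}|lebesgue. D x)))"
    by (rule set_lebesgue_integral_cong) (auto simp: P)
  also have "\<dots> = - (LINT t:{a..b}|lebesgue. deriv u t * (LINT x:{t..b}|lebesgue. D x))"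
    by (simp add: set_lebesgue_integral_def)
  also have "(LINT t:{a..b}|lebesgue. deriv u t * (LINT x:{t..b}|lebesgue. D x))
      = (LINT x:{a..b}|lebesgue. D x * (LINT t:{a..x}|lebesgue. deriv u t))"
    by (rule indefinite_integral_Fubini(3)[OF Di u'(1), symmetric])
  also have "\<dots> = (LINT x:{a..b}|lebesgue. D x * u x - D x * u a)"
    by (rule set_lebesgue_integral_cong) (auto simp: u'(2) algebra_simps)
  also have "\<dots> = (LINT x:{a..b}|lebesgue. D x * u x)"
    using Di Dui by (simp add: set_integral_diff D0)
  finally have 1: "(LINT x:{a..b}|lebesgue. p x * caputo_left a \<alpha> u x) = - (LINT x:{a..b}|lebesgue. D x * u x) / c" .
  have ui: "set_integrable lebesgue {a..b} u"
    by (rule continuous_on_set_integrable_lebesgue[OF uD(2)])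
  have 2: "(LINT x:{a..b}|lebesgue. q x * rl_int_left a \<beta> u x) = (LINT x:{a..b}|lebesgue. u x * R x)"
    using powr_kernel_Fubini(2)[OF \<open>\<beta> > 0\<close> q ui]
    by (simp add: R_def rl_int_left_def rl_int_right_def)
  have uRi: "set_integrable lebesgue {a..b} (\<lambda>x. u x * R x)"
    using powr_kernel_Fubini(1)[OF \<open>\<beta> > 0\<close> q ui] by (simp add: R_def rl_int_right_def)
  have Aui: "set_integrable lebesgue {a..b} (\<lambda>x. A x * u x)"
    by (intro continuous_on_set_integrable_lebesgue continuous_intros A uD)
  have pCi: "set_integrable lebesgue {a..b} (\<lambda>x. p x * caputo_left a \<alpha> u x)"
    by (intro continuous_on_set_integrable_lebesgue continuous_intros p uD)
  have qIi: "set_integrable lebesgue {a..b} (\<lambda>x. q x * rl_int_left a \<beta> u x)"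
    by (intro continuous_on_set_integrable_lebesgue continuous_intros q uD)
  have "(LINT x:{a..b}|lebesgue. A x * u x + p x * caputo_left a \<alpha> u x + q x * rl_int_left a \<beta> u x)
      = (LINT x:{a..b}|lebesgue. A x * u x) - (LINT x:{a..b}|lebesgue. D x * u x) / c + (LINT x:{a..b}|lebesgue. u x * R x)"
    using Aui pCi qIi by (simp add: set_integral_add 1 2)
  also have "\<dots> = (LINT x:{a..b}|lebesgue. A x * u x - D x * u x / c + u x * R x)"
    using Aui Dui uRi by (simp add: set_integral_add set_integral_diff)
  also have "\<dots> = (LINT x:{a..b}|lebesgue. 0)"
    by (rule set_lebesgue_integral_cong) (use c in \<open>auto simp: D field_simps\<close>)
  finally show ?thesis by simp
qed

section \<open>Continuity along the states and additivity of the fractional operators\<close>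

lemma C1_on_imp_continuous_on: "C1_on D \<Psi> \<Longrightarrow> continuous_on D \<Psi>"
  unfolding C1_on_def by (meson has_derivative_continuous_on)

lemma continuous_on_state4:
  assumes "u \<in> admissible a b \<alpha> \<beta>"
  shows "continuous_on {a..b} (state4 a \<alpha> \<beta> u)"
  unfolding state4_def[abs_def] by (intro continuous_intros admissibleD[OF assms])

lemma continuous_on_comp_state4:
  assumes "u \<in> admissible a b \<alpha> \<beta>" "continuous_on (dom_on a b) f"
  shows "continuous_on {a..b} (\<lambda>x. f (state4 a \<alpha> \<beta> u x))"
  by (rule continuous_on_compose2[OF assms(2) continuous_on_state4[OF assms(1)]])
    (auto simp: dom_on_def state4_def)

lemma continuous_on_indef:
  assumes "u \<in> admissible a b \<alpha> \<beta>" "continuous_on (dom_on a b) l"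
  shows "continuous_on {a..b} (indef a \<alpha> \<beta> l u)"
proof -
  let ?f = "\<lambda>t. l (state4 a \<alpha> \<beta> u t)"
  have c: "continuous_on {a..b} ?f" by (rule continuous_on_comp_state4[OF assms])
  have "continuous_on {a..b} (\<lambda>x. integral {a..x} ?f)"
    by (intro indefinite_integral_continuous_1 integrable_continuous_real c)
  moreover have "integral {a..x} ?f = indef a \<alpha> \<beta> l u x" if "x \<in> {a..b}" for x
    unfolding indef_def
    by (intro set_lebesgue_integral_eq_integral(2)[symmetric] continuous_on_set_integrable_lebesgue
        continuous_on_subset[OF c]) (use that in auto)
  ultimately show ?thesis by (metis (mono_tags, lifting) continuous_on_cong)
qed

lemma continuous_on_comp_state5:
  assumes "u \<in> admissible a b \<alpha> \<beta>" "continuous_on (dom_on a b) l" "continuous_on (dom_on a b) f"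
  shows "continuous_on {a..b} (\<lambda>x. f (state5 a \<alpha> \<beta> l u x))"
proof -
  have "continuous_on {a..b} (state5 a \<alpha> \<beta> l u)"
    unfolding state5_def[abs_def]
    by (intro continuous_intros admissibleD[OF assms(1)] continuous_on_indef[OF assms(1,2)])
  then show ?thesis
    by (rule continuous_on_compose2[OF assms(3)]) (auto simp: dom_on_def state5_def)
qed

lemma continuous_on_tail_integral:
  fixes f :: "real \<Rightarrow> real"
  assumes "continuous_on {a..b} f"
  shows "continuous_on {a..b} (\<lambda>x. LINT t:{x..b}|lebesgue. f t)"
proof -
  have "continuous_on {a..b} (\<lambda>x. integral {x..b} f)"
    by (intro indefinite_integral_continuous_1' integrable_continuous_real assms)
  moreover have "integral {x..b} f = (LINT t:{x..b}|lebesgue. f t)" if "x \<in> {a..b}" for x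
    by (intro set_lebesgue_integral_eq_integral(2)[symmetric] continuous_on_set_integrable_lebesgue
        continuous_on_subset[OF assms]) (use that in auto)
  ultimately show ?thesis by (metis (mono_tags, lifting) continuous_on_cong)
qed

lemma rl_int_right_add:
  assumes "\<beta> > 0" "continuous_on {a..b} f" "continuous_on {a..b} g" "x \<in> {a..b}"
  shows "rl_int_right b \<beta> (\<lambda>t. f t + g t) x = rl_int_right b \<beta> f x + rl_int_right b \<beta> g x"
proof -
  have "set_integrable lebesgue {x..b} (\<lambda>t. (t - x) powr (\<beta> - 1) * f t)"
    "set_integrable lebesgue {x..b} (\<lambda>t. (t - x) powr (\<beta> - 1) * g t)"
    using powr_kernel_slice[OF assms(1,2)] powr_kernel_slice[OF assms(1,3)] assms(4) by metis+
  then show ?thesis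
    by (simp add: rl_int_right_def distrib_left set_integral_add add_divide_distrib)
qed

text \<open>The Euler-Lagrange equation holds two separate fractional derivatives; this merges them
  into one derivative of a single kernel integral. The factor \<open>- Gamma (1 - \<alpha>)\<close>
  undoes the normalization of \<open>rl_deriv_right\<close>.\<close>

lemma rl_deriv_right_add:
  assumes ex: "rl_deriv_right_exists a b \<alpha> f x" "rl_deriv_right_exists a b \<alpha> g x"
    and x: "x \<in> {a..b}" and "a < b" "\<alpha> < 1"
  shows "((\<lambda>u. LINT t:{u..b}|lebesgue. (t - u) powr (- \<alpha>) * (f t + g t)) has_vector_derivative
      - Gamma (1 - \<alpha>) * (rl_deriv_right a b \<alpha> f x + rl_deriv_right a b \<alpha> g x)) (at x within {a..b})"
proof -
  let ?I = "\<lambda>f u. LINT t:{u..b}|lebesgue. (t - u) powr (- \<alpha>) * f t"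
  have c: "Gamma (1 - \<alpha>) > 0" using \<open>\<alpha> < 1\<close> by (simp add: Gamma_real_pos)
  have d: "(?I h has_vector_derivative - Gamma (1 - \<alpha>) * rl_deriv_right a b \<alpha> h x) (at x within {a..b})"
    if "rl_deriv_right_exists a b \<alpha> h x" for h
    using that c by (simp add: rl_deriv_right_exists_def rl_deriv_right_def vector_derivative_works)
  have "((\<lambda>u. ?I f u + ?I g u) has_vector_derivative
      - Gamma (1 - \<alpha>) * (rl_deriv_right a b \<alpha> f x + rl_deriv_right a b \<alpha> g x)) (at x within {a..b})"
    using has_vector_derivative_add[OF d[OF ex(1)] d[OF ex(2)]] by (simp add: algebra_simps)
  then show ?thesis
  proof (rule has_vector_derivative_transform[rotated -1])
    fix u assume "u \<in> {a..b}"
    then show "?I (\<lambda>t. f t + g t) u = ?I f u + ?I g u"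
      using ex by (simp add: distrib_left set_integral_add rl_deriv_right_exists_def)
  qed (rule x)
qed

section \<open>Convexity inequalities between two states\<close>

text \<open>The convexity inequality is applied to the difference of the two states at the same
  \<open>x\<close>, so the increment in the first variable is 0.\<close>

lemma convex_in_state5:
  assumes "convex_in {Ly, Lv, Lw, Lz} (dom_on a b) L" "x \<in> {a..b}"
  shows "L (state5 a \<alpha> \<beta> l u x) - L (state5 a \<alpha> \<beta> l y x) \<ge>
    dL a b \<alpha> \<beta> L l y Ly x * (u x - y x)
    + dL a b \<alpha> \<beta> L l y Lv x * (caputo_left a \<alpha> u x - caputo_left a \<alpha> y x)
    + dL a b \<alpha> \<beta> L l y Lw x * (rl_int_left a \<beta> u x - rl_int_left a \<beta> y x)
    + dL a b \<alpha> \<beta> L l y Lz x * (indef a \<alpha> \<beta> l u x - indef a \<alpha> \<beta> l y x)"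
proof -
  let ?p = "state5 a \<alpha> \<beta> l y x" and ?\<tau> = "state5 a \<alpha> \<beta> l u x - state5 a \<alpha> \<beta> l y x"
  have "?p \<in> dom_on a b" "?p + ?\<tau> \<in> dom_on a b"
    using assms(2) by (auto simp: dom_on_def state5_def)
  then have "L (?p + ?\<tau>) - L ?p \<ge> (\<Sum>i\<in>{Ly, Lv, Lw, Lz}. partial_deriv (dom_on a b) L i ?p * (?\<tau> \<bullet> i))"
    using assms(1) unfolding convex_in_def by blast
  then show ?thesis
    by (simp add: dL_def Ly_def Lv_def Lw_def Lz_def state5_def)
qed

text \<open>The first-order part of the increment of \<open>l\<close> is named because it bounds
  that increment from below in the convex case and from above in the concave case.\<close>

definition dl_increment ::
  "real \<Rightarrow> real \<Rightarrow> real \<Rightarrow> real \<Rightarrow> (arg4 \<Rightarrow> real) \<Rightarrow> (real \<Rightarrow> real) \<Rightarrow> (real \<Rightarrow> real) \<Rightarrow> real \<Rightarrow> real" where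
  "dl_increment a b \<alpha> \<beta> l y u x =
     dl a b \<alpha> \<beta> l y ly x * (u x - y x)
     + dl a b \<alpha> \<beta> l y lv x * (caputo_left a \<alpha> u x - caputo_left a \<alpha> y x)
     + dl a b \<alpha> \<beta> l y lw x * (rl_int_left a \<beta> u x - rl_int_left a \<beta> y x)"

lemma sum_partial_deriv_state4:
  "(\<Sum>i\<in>{ly, lv, lw}. partial_deriv (dom_on a b) l i (state4 a \<alpha> \<beta> y x) *
      ((state4 a \<alpha> \<beta> u x - state4 a \<alpha> \<beta> y x) \<bullet> i)) = dl_increment a b \<alpha> \<beta> l y u x"
  by (simp add: dl_increment_def dl_def ly_def lv_def lw_def state4_def)

lemma convex_in_state4:
  assumes "convex_in {ly, lv, lw} (dom_on a b) l" "x \<in> {a..b}"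
  shows "l (state4 a \<alpha> \<beta> u x) - l (state4 a \<alpha> \<beta> y x) \<ge> dl_increment a b \<alpha> \<beta> l y u x"
proof -
  let ?p = "state4 a \<alpha> \<beta> y x" and ?\<tau> = "state4 a \<alpha> \<beta> u x - state4 a \<alpha> \<beta> y x"
  have "?p \<in> dom_on a b" "?p + ?\<tau> \<in> dom_on a b"
    using assms(2) by (auto simp: dom_on_def state4_def)
  then have "l (?p + ?\<tau>) - l ?p \<ge> (\<Sum>i\<in>{ly, lv, lw}. partial_deriv (dom_on a b) l i ?p * (?\<tau> \<bullet> i))"
    using assms(1) unfolding convex_in_def by blast
  then show ?thesis unfolding sum_partial_deriv_state4 by simp
qed

lemma concave_in_state4:
  assumes "concave_in {ly, lv, lw} (dom_on a b) l" "x \<in> {a..b}"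
  shows "l (state4 a \<alpha> \<beta> u x) - l (state4 a \<alpha> \<beta> y x) \<le> dl_increment a b \<alpha> \<beta> l y u x"
proof -
  let ?p = "state4 a \<alpha> \<beta> y x" and ?\<tau> = "state4 a \<alpha> \<beta> u x - state4 a \<alpha> \<beta> y x"
  have "?p \<in> dom_on a b" "?p + ?\<tau> \<in> dom_on a b"
    using assms(2) by (auto simp: dom_on_def state4_def)
  then have "l (?p + ?\<tau>) - l ?p \<le> (\<Sum>i\<in>{ly, lv, lw}. partial_deriv (dom_on a b) l i ?p * (?\<tau> \<bullet> i))"
    using assms(1) unfolding concave_in_def by blast
  then show ?thesis unfolding sum_partial_deriv_state4 by simp
qed

section \<open>Comparison of the functional at two admissible functions\<close>

theorem theorem27:
  fixes a b \<alpha> \<beta> :: real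
    and L :: "arg5 \<Rightarrow> real" and l :: "arg4 \<Rightarrow> real" and y :: "real \<Rightarrow> real"
  assumes "a < b" and "\<alpha> \<in> {0<..<1}" and "\<beta> > 0"
    and "C1_on (dom_on a b) L" and "C1_on (dom_on a b) l"
    and "y \<in> admissible a b \<alpha> \<beta>"
    and "euler_lagrange a b \<alpha> \<beta> L l y"
    and "natural_boundary a b \<alpha> \<beta> L l y"
    and "convex_in {Ly, Lv, Lw, Lz} (dom_on a b) L"
    and "(convex_in {ly, lv, lw} (dom_on a b) l \<and> (\<forall>x\<in>{a..b}. dL a b \<alpha> \<beta> L l y Lz x \<ge> 0)) \<or>
         (concave_in {ly, lv, lw} (dom_on a b) l \<and> (\<forall>x\<in>{a..b}. dL a b \<alpha> \<beta> L l y Lz x \<le> 0))"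
  shows "is_arg_min (functional_J a b \<alpha> \<beta> L l) (\<lambda>u. u \<in> admissible a b \<alpha> \<beta>) y"
proof -
  note y = \<open>y \<in> admissible a b \<alpha> \<beta>\<close>
  have \<alpha>: "0 < \<alpha>" "\<alpha> < 1" using assms(2) by auto
  have \<Gamma>: "Gamma (1 - \<alpha>) > 0" using \<alpha>(2) by (intro Gamma_real_pos) simp
  have contL: "continuous_on (dom_on a b) L" and contl: "continuous_on (dom_on a b) l"
    using assms(4,5) by (auto intro: C1_on_imp_continuous_on)
  let ?D = "\<lambda>i x. dL a b \<alpha> \<beta> L l y i x" and ?d = "\<lambda>i x. dl a b \<alpha> \<beta> l y i x"
  define T where "T = tail_Lz a b \<alpha> \<beta> L l y"
  \<comment> \<open>Continuity of the partial derivatives is a clause of \<open>convex_in\<close>,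
    and the state of \<open>y\<close> is continuous.\<close>
  have cD: "continuous_on {a..b} (?D i)" if "i \<in> {Ly, Lv, Lw, Lz}" for i
    unfolding dL_def using assms(9) that
    by (intro continuous_on_comp_state5[OF y contl]) (auto simp: convex_in_def)
  have cd: "continuous_on {a..b} (?d i)" if "i \<in> {ly, lv, lw}" for i
    unfolding dl_def using assms(10) that
    by (intro continuous_on_comp_state4[OF y]) (auto simp: convex_in_def concave_in_def)
  have T_eq: "T x = (LINT t:{x..b}|lebesgue. ?D Lz t)" for x
    by (simp add: T_def tail_Lz_def)
  have cT: "continuous_on {a..b} T"
    unfolding T_eq[abs_def] by (rule continuous_on_tail_integral[OF cD]) simp
  \<comment> \<open>\<open>A\<close>, \<open>p\<close> and \<open>q\<close> collect the coefficients
    of the function, its Caputo derivative and its fractional integral, so that the six terms of the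
    equation become three.\<close>
  define A where "A = (\<lambda>x. ?D Ly x + T x * ?d ly x)"
  define p where "p = (\<lambda>x. ?D Lv x + T x * ?d lv x)"
  define q where "q = (\<lambda>x. ?D Lw x + T x * ?d lw x)"
  have cA: "continuous_on {a..b} A" and cp: "continuous_on {a..b} p" and cq: "continuous_on {a..b} q"
    unfolding A_def p_def q_def by (intro continuous_intros cD cd cT; simp)+
  define E where "E = (\<lambda>x. - Gamma (1 - \<alpha>) *
    (rl_deriv_right a b \<alpha> (?D Lv) x + rl_deriv_right a b \<alpha> (\<lambda>s. T s * ?d lv s) x))"
  have weak: "(LINT x:{a..b}|lebesgue. A x * u x + p x * caputo_left a \<alpha> u x + q x * rl_int_left a \<beta> u x) = 0"
    if "u \<in> admissible a b \<alpha> \<beta>" for u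
  proof (rule weak_euler_lagrange[OF \<open>a < b\<close> \<alpha> \<open>\<beta> > 0\<close> that cA cp cq])
    fix x assume x: "x \<in> {a..b}"
    from assms(7) x have ex: "rl_deriv_right_exists a b \<alpha> (?D Lv) x"
        "rl_deriv_right_exists a b \<alpha> (\<lambda>s. T s * ?d lv s) x"
      and eq: "?D Ly x + rl_deriv_right a b \<alpha> (?D Lv) x + rl_int_right b \<beta> (?D Lw) x + T x * ?d ly x
        + rl_deriv_right a b \<alpha> (\<lambda>s. T s * ?d lv s) x + rl_int_right b \<beta> (\<lambda>s. T s * ?d lw s) x = 0"
      unfolding euler_lagrange_def T_def by auto
    show "((\<lambda>u. LINT t:{u..b}|lebesgue. (t - u) powr (- \<alpha>) * p t) has_vector_derivative E x) (at x within {a..b})"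
      unfolding p_def E_def by (rule rl_deriv_right_add[OF ex x \<open>a < b\<close> \<alpha>(2)])
    have "rl_int_right b \<beta> q x = rl_int_right b \<beta> (?D Lw) x + rl_int_right b \<beta> (\<lambda>s. T s * ?d lw s) x"
      unfolding q_def
      by (rule rl_int_right_add[OF \<open>\<beta> > 0\<close> _ _ x]) (intro continuous_intros cD cd cT; simp)+
    then show "A x - E x / Gamma (1 - \<alpha>) + rl_int_right b \<beta> q x = 0"
      using eq \<Gamma> by (simp add: A_def E_def)
  next
    \<comment> \<open>The fractional integral of order \<open>1 - \<alpha>\<close> has kernel
      exponent \<open>- \<alpha>\<close>; its nonzero Gamma factor cancels.\<close>
    show "(LINT t:{a..b}|lebesgue. (t - a) powr (- \<alpha>) * p t) = 0"
      using assms(8) \<Gamma>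
      by (simp add: natural_boundary_def rl_int_right_def p_def T_def)
  qed
  have "functional_J a b \<alpha> \<beta> L l y \<le> functional_J a b \<alpha> \<beta> L l u" if u: "u \<in> admissible a b \<alpha> \<beta>" for u
  proof -
    note si = continuous_on_set_integrable_lebesgue
    note yD = admissibleD[OF y] and uD = admissibleD[OF u]
    define \<Delta>l where "\<Delta>l = (\<lambda>x. l (state4 a \<alpha> \<beta> u x) - l (state4 a \<alpha> \<beta> y x))"
    define \<Delta>z where "\<Delta>z = (\<lambda>x. indef a \<alpha> \<beta> l u x - indef a \<alpha> \<beta> l y x)"
    \<comment> \<open>The first-order part of the increment of \<open>L\<close> without its
      \<open>z\<close>-term, which needs the exchange of integrals below.\<close>
    define W where "W = (\<lambda>x. ?D Ly x * (u x - y x)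
      + ?D Lv x * (caputo_left a \<alpha> u x - caputo_left a \<alpha> y x)
      + ?D Lw x * (rl_int_left a \<beta> u x - rl_int_left a \<beta> y x))"
    have cl: "continuous_on {a..b} (\<lambda>x. l (state4 a \<alpha> \<beta> u x))" "continuous_on {a..b} (\<lambda>x. l (state4 a \<alpha> \<beta> y x))"
      by (rule continuous_on_comp_state4[OF _ contl], fact)+
    have c\<Delta>l: "continuous_on {a..b} \<Delta>l"
      unfolding \<Delta>l_def by (intro continuous_intros cl)
    have c\<Delta>z: "continuous_on {a..b} \<Delta>z"
      unfolding \<Delta>z_def by (intro continuous_intros continuous_on_indef[OF _ contl] u y)
    have cW: "continuous_on {a..b} W"
      unfolding W_def by (intro continuous_intros cD yD uD; simp)
    have cdl: "continuous_on {a..b} (dl_increment a b \<alpha> \<beta> l y u)"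
      unfolding dl_increment_def[abs_def] by (intro continuous_intros cd yD uD; simp)
    have \<Delta>z: "\<Delta>z x = (LINT t:{a..x}|lebesgue. \<Delta>l t)" if "x \<in> {a..b}" for x
    proof -
      have "set_integrable lebesgue {a..x} (\<lambda>x. l (state4 a \<alpha> \<beta> u x))"
        "set_integrable lebesgue {a..x} (\<lambda>x. l (state4 a \<alpha> \<beta> y x))"
        by (rule si, rule continuous_on_subset, rule cl, use that in auto)+
      then show ?thesis by (simp add: \<Delta>z_def \<Delta>l_def indef_def set_integral_diff)
    qed
    have "(LINT x:{a..b}|lebesgue. ?D Lz x * \<Delta>z x)
        = (LINT x:{a..b}|lebesgue. ?D Lz x * (LINT t:{a..x}|lebesgue. \<Delta>l t))"
      by (rule set_lebesgue_integral_cong) (auto simp: \<Delta>z)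
    also have "\<dots> = (LINT t:{a..b}|lebesgue. \<Delta>l t * T t)"
      unfolding T_eq by (rule indefinite_integral_Fubini(3)) (intro si cD c\<Delta>l; simp)+
    finally have swap: "(LINT x:{a..b}|lebesgue. ?D Lz x * \<Delta>z x) = (LINT t:{a..b}|lebesgue. \<Delta>l t * T t)" .
    \<comment> \<open>\<open>T\<close> inherits the sign of the \<open>z\<close>-derivative. A
      nonnegative \<open>T\<close> keeps the lower bound from convexity, and a nonpositive
      \<open>T\<close> reverses the upper bound from concavity, so both cases give the same
      inequality.\<close>
    have T_le: "dl_increment a b \<alpha> \<beta> l y u x * T x \<le> \<Delta>l x * T x" if x: "x \<in> {a..b}" for x
      using assms(10)
    proof (elim disjE conjE)
      assume *: "convex_in {ly, lv, lw} (dom_on a b) l" "\<forall>x\<in>{a..b}. ?D Lz x \<ge> 0"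
      have "0 \<le> T x" unfolding T_eq set_lebesgue_integral_def
        using * x by (intro integral_nonneg_AE AE_I2) (auto simp: indicator_def)
      then show ?thesis
        using convex_in_state4[OF *(1) x] by (intro mult_right_mono) (auto simp: \<Delta>l_def)
    next
      assume *: "concave_in {ly, lv, lw} (dom_on a b) l" "\<forall>x\<in>{a..b}. ?D Lz x \<le> 0"
      have "0 \<le> (LINT t:{x..b}|lebesgue. - ?D Lz t)" unfolding set_lebesgue_integral_def
        using * x by (intro integral_nonneg_AE AE_I2) (auto simp: indicator_def)
      then have "T x \<le> 0" by (simp add: T_eq set_lebesgue_integral_def)
      then show ?thesis
        using concave_in_state4[OF *(1) x] by (intro mult_right_mono_neg) (auto simp: \<Delta>l_def)
    qed
    have ci: "set_integrable lebesgue {a..b} (\<lambda>x. A x * w x + p x * caputo_left a \<alpha> w x + q x * rl_int_left a \<beta> w x)"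
      if "w \<in> admissible a b \<alpha> \<beta>" for w
      by (intro si continuous_intros cA cp cq admissibleD[OF that])
    \<comment> \<open>The weak equation is used for \<open>u\<close> and for \<open>y\<close>
      separately and then subtracted. Regrouping separates the derivatives of \<open>L\<close> in
      \<open>W\<close> from those of \<open>l\<close>, which carry the factor
      \<open>T\<close>.\<close>
    have "0 = (LINT x:{a..b}|lebesgue. (A x * u x + p x * caputo_left a \<alpha> u x + q x * rl_int_left a \<beta> u x)
        - (A x * y x + p x * caputo_left a \<alpha> y x + q x * rl_int_left a \<beta> y x))"
      using weak[OF u] weak[OF y] by (simp add: set_integral_diff(2)[OF ci[OF u] ci[OF y]])
    also have "\<dots> = (LINT x:{a..b}|lebesgue. W x + dl_increment a b \<alpha> \<beta> l y u x * T x)"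
      by (rule set_lebesgue_integral_cong)
        (auto simp: W_def dl_increment_def A_def p_def q_def algebra_simps)
    also have "\<dots> \<le> (LINT x:{a..b}|lebesgue. W x + \<Delta>l x * T x)"
      by (rule set_integral_mono) (intro si continuous_intros cW cdl cT c\<Delta>l add_left_mono T_le; simp)+
    also have "\<dots> = (LINT x:{a..b}|lebesgue. W x) + (LINT x:{a..b}|lebesgue. ?D Lz x * \<Delta>z x)"
      unfolding swap by (rule set_integral_add(2)) (intro si continuous_intros cW cT c\<Delta>l)+
    also have "\<dots> = (LINT x:{a..b}|lebesgue. W x + ?D Lz x * \<Delta>z x)"
      by (rule set_integral_add(2)[symmetric]) (intro si continuous_intros cW cD c\<Delta>z; simp)+
    also have "\<dots> \<le> (LINT x:{a..b}|lebesgue. L (state5 a \<alpha> \<beta> l u x) - L (state5 a \<alpha> \<beta> l y x))"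
    proof (rule set_integral_mono)
      fix x assume "x \<in> {a..b}"
      from convex_in_state5[OF assms(9) this]
      show "W x + ?D Lz x * \<Delta>z x \<le> L (state5 a \<alpha> \<beta> l u x) - L (state5 a \<alpha> \<beta> l y x)"
        by (simp add: W_def \<Delta>z_def)
    qed (intro si continuous_intros cW cD c\<Delta>z continuous_on_comp_state5[OF _ contl contL] u y; simp)+
    also have "\<dots> = functional_J a b \<alpha> \<beta> L l u - functional_J a b \<alpha> \<beta> L l y"
      unfolding functional_J_def
      by (rule set_integral_diff(2)) (intro si continuous_on_comp_state5[OF _ contl contL] u y)+
    finally show ?thesis by simp
  qed
  then show ?thesis
    using y by (auto simp: is_arg_min_def not_less)
qed

end
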